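(* Let $X$ be a Cantor space, let $K_0 \subset K \subset C_s(X)$ be nonempty subsets, and let $\mathcal{Q}$ be a collection of surjective relations on elements of $\mathcal{I}$. Then: \begin{itemize} \item[(a)] $\Gamma(\Gamma^*(\mathcal{Q})) \subset \mathcal{Q}$, $K \subset \Gamma^*(\Gamma(K))$, and $\Gamma^*(\Gamma(\Gamma^*(\mathcal{Q}))) = \Gamma^*(\mathcal{Q})$, $\Gamma(K) = \Gamma(\Gamma^*(\Gamma(K)))$. \item[(b)] $\Gamma^*(\mathcal{Q}) \subset C_s(X)$ is closed and conjugacy invariant. \item[(c)] $\Gamma(K)$ satisfies Condition $\Gamma$. \item[(d)] If $K_0$ is dense in $K$, then $\Gamma(K_0) = \Gamma(K)$. \item[(e)] If $K_0$ and $K$ are conjugacy invariant and $\Gamma(K_0) = \Gamma(K)$, then $K_0$ is dense in $K$. \item[(f)] If $K$ is closed in $C_s(X)$ and is conjugacy invariant then $K = \Gamma^*(\Gamma(K))$. If $K \subset H(X)$ is closed in $H(X)$ and is conjugacy invariant then $K = H(X) \cap \Gamma^*(\Gamma(K))$. \item[(g)] If $\mathcal{Q}$ satisfies Condition $\Gamma$ then $\mathcal{Q} = \Gamma(\Gamma^*(\mathcal{Q})) = \Gamma(H(X) \cap \Gamma^*(\mathcal{Q}))$. \end{itemize}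
   Context: A Cantor space is a nonempty, compact, zero-dimensional, perfect metric space. $C_s(X)$ is the space of continuous surjections $X\to X$ with the sup metric; $H(X)\subset C_s(X)$ is the homeomorphism group, acting on $C_s(X)$ by $f \mapsto h\circ f\circ h^{-1}$; a subset of $C_s(X)$ is conjugacy invariant if it is invariant under this action. $\mathbb{N}$ is the set of positive integers; $\mathcal{I}$ is the set of all nonempty finite subsets of $\mathbb{N}^n$, $n=1,2,\dots$ (discrete topology). A surjective relation on $I$ is a subset $\phi\subset I\times I$ both of whose coordinate projections are onto $I$. A partition is a continuous surjection $\alpha: X\to I$ with $I\in\mathcal{I}$, and $f^\alpha=(\alpha\times\alpha)(f)=\{(\alpha(x),\alpha(f(x))):x\in X\}$. For $f\in C_s(X)$, $\Gamma(f)$ is the set of surjective relations $\phi$ on elements of $\mathcal{I}$ such that $\phi=f^\alpha$ for some partition $\alpha$; for $K\subset C_s(X)$, $\Gamma(K)=\bigcup_{f\in K}\Gamma(f)$. $\Gamma^*(\mathcal{Q})=\{f\in C_s(X):\Gamma(f)\subset\mathcal{Q}\}$. For surjective relations $\phi$ on $I$, $\psi$ on $J$: $\psi$ is a factor of $\phi$ if there is a surjection $\pi:I\to J$ with $(\pi\times\pi)(\phi)=\psi$. A surjective relation $\phi_1$ on $I_1\in\mathcal I$ is a $+$directional lift of $\phi$ on $I\in\mathcal I$ if there is a surjection $\pi:I_1\to I$ with (i) $(\pi\times\pi)(\phi_1)=\phi$; (ii) $\pi\circ\phi_1=\{(a,\pi(b)):(a,b)\in\phi_1\}$ is (the graph of)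 a map $I_1\to I$; (iii) $\pi^{-1}(i)$ contains more than one element for every $i\in I$. A nonempty collection $\mathcal{Q}$ of surjective relations on elements of $\mathcal{I}$ satisfies Condition $\Gamma$ if every factor (on an element of $\mathcal I$) of an element of $\mathcal{Q}$ is in $\mathcal{Q}$, and every $\phi\in\mathcal{Q}$ has a $+$directional lift $\psi\in\mathcal{Q}$. *)

theory Defs
  imports "HOL-Analysis.Analysis"
begin

definition zero_dimensional :: "'a::metric_space set \<Rightarrow> bool" where
  "zero_dimensional S \<longleftrightarrow>
     (\<forall>U x. openin (top_of_set S) U \<and> x \<in> U \<longrightarrow>
        (\<exists>V. openin (top_of_set S) V \<and> closedin (top_of_set S) V \<and> x \<in> V \<and> V \<subseteq> U))"

definition perfect_space :: "'a::metric_space set \<Rightarrow> bool" where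
  "perfect_space S \<longleftrightarrow> (\<forall>x\<in>S. x islimpt S)"

definition cantor_space :: "'a::metric_space set \<Rightarrow> bool" where
  "cantor_space S \<longleftrightarrow> S \<noteq> {} \<and> compact S \<and> zero_dimensional S \<and> perfect_space S"


text \<open>
  The Cantor space \<open>X\<close> is the whole type \<open>'a\<close>. Continuous maps on \<open>X\<close> are elements of
  \<open>'a \<Rightarrow>\<^sub>C 'a\<close>, whose library metric is the sup metric; boundedness is automatic since
  \<open>X\<close> is compact.
\<close>

definition Cs :: "('a::metric_space \<Rightarrow>\<^sub>C 'a) set" where
  "Cs = {f. surj (apply_bcontfun f)}"

definition Homeo :: "('a::metric_space \<Rightarrow>\<^sub>C 'a) set" where
  "Homeo = {h. \<exists>g. homeomorphism UNIV UNIV (apply_bcontfun h) g}"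

definition conjugate ::
    "('a::metric_space \<Rightarrow>\<^sub>C 'a) \<Rightarrow> ('a \<Rightarrow>\<^sub>C 'a) \<Rightarrow> ('a \<Rightarrow>\<^sub>C 'a)" where
  "conjugate h f = Bcontfun (apply_bcontfun h \<circ> apply_bcontfun f \<circ> inv (apply_bcontfun h))"

definition conjugacy_invariant :: "('a::metric_space \<Rightarrow>\<^sub>C 'a) set \<Rightarrow> bool" where
  "conjugacy_invariant K \<longleftrightarrow> (\<forall>h\<in>Homeo. \<forall>f\<in>K. conjugate h f \<in> K)"

lemma Bcontfun_inverse_compact:
  fixes f :: "'a::metric_space \<Rightarrow> 'a"
  assumes "compact (UNIV :: 'a set)" "continuous_on UNIV f"
  shows "apply_bcontfun (Bcontfun f) = f"
  using assms
  by (intro Bcontfun_inverse) (auto simp: bcontfun_def intro: compact_imp_bounded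
      compact_continuous_image)

text \<open>
  The value of \<open>conjugate h f\<close> is \<open>h \<circ> f \<circ> h\<^sup>-\<^sup>1\<close>, so the use of \<open>Bcontfun\<close> is harmless.
\<close>

lemma Homeo_inv:
  assumes "h \<in> Homeo"
  shows "homeomorphism UNIV UNIV (apply_bcontfun h) (inv (apply_bcontfun h))"
proof -
  obtain g where g: "homeomorphism UNIV UNIV (apply_bcontfun h) g"
    using assms by (auto simp: Homeo_def)
  have "inv (apply_bcontfun h) = g"
    using g by (intro inv_unique_comp) (auto simp: homeomorphism_def fun_eq_iff)
  with g show ?thesis by simp
qed

lemma apply_conjugate:
  fixes h f :: "'a::metric_space \<Rightarrow>\<^sub>C 'a"
  assumes "compact (UNIV :: 'a set)" "h \<in> Homeo"
  shows "apply_bcontfun (conjugate h f) =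
           apply_bcontfun h \<circ> apply_bcontfun f \<circ> inv (apply_bcontfun h)"
proof -
  have "continuous_on UNIV (inv (apply_bcontfun h))"
    using Homeo_inv[OF assms(2)] by (auto simp: homeomorphism_def)
  then show ?thesis
    unfolding conjugate_def
    by (intro Bcontfun_inverse_compact assms(1) continuous_on_compose
        continuous_on_apply_bcontfun)
qed

lemma Homeo_subset_Cs: "Homeo \<subseteq> Cs"
  by (auto simp: Homeo_def Cs_def homeomorphism_def)


text \<open>
  A point of \<open>\<nat>\<^sup>n\<close>, where \<open>\<nat>\<close> consists of the positive integers, is a list of length \<open>n\<close>
  with positive entries.
\<close>

type_synonym index = "nat list"

definition index_sets :: "index set set" where
  "index_sets = {I. finite I \<and> I \<noteq> {} \<and>
     (\<exists>n\<ge>1. I \<subseteq> {xs. length xs = n \<and> (\<forall>k\<in>set xs. k \<ge> 1)})}"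

definition surj_rel_on :: "index set \<Rightarrow> index rel \<Rightarrow> bool" where
  "surj_rel_on I \<phi> \<longleftrightarrow> \<phi> \<subseteq> I \<times> I \<and> fst ` \<phi> = I \<and> snd ` \<phi> = I"

definition surj_rels :: "index rel set" where
  "surj_rels = {\<phi>. \<exists>I\<in>index_sets. surj_rel_on I \<phi>}"

definition partition_map :: "index set \<Rightarrow> ('a::metric_space \<Rightarrow> index) \<Rightarrow> bool" where
  "partition_map I \<alpha> \<longleftrightarrow>
     I \<in> index_sets \<and> continuous_map euclidean (discrete_topology I) \<alpha> \<and> range \<alpha> = I"

definition image_rel :: "('a::metric_space \<Rightarrow>\<^sub>C 'a) \<Rightarrow> ('a \<Rightarrow> index) \<Rightarrow> index rel" where
  "image_rel f \<alpha> = {(\<alpha> x, \<alpha> (apply_bcontfun f x)) | x. True}"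

definition Gamma :: "('a::metric_space \<Rightarrow>\<^sub>C 'a) \<Rightarrow> index rel set" where
  "Gamma f = {\<phi> \<in> surj_rels. \<exists>I \<alpha>. partition_map I \<alpha> \<and> \<phi> = image_rel f \<alpha>}"

definition Gamma_set :: "('a::metric_space \<Rightarrow>\<^sub>C 'a) set \<Rightarrow> index rel set" where
  "Gamma_set K = (\<Union>f\<in>K. Gamma f)"

definition Gamma_star :: "index rel set \<Rightarrow> ('a::metric_space \<Rightarrow>\<^sub>C 'a) set" where
  "Gamma_star Q = {f \<in> Cs. Gamma f \<subseteq> Q}"

definition factor_of :: "index rel \<Rightarrow> index rel \<Rightarrow> bool" where
  "factor_of \<psi> \<phi> \<longleftrightarrow>
     (\<exists>I J \<pi>. surj_rel_on I \<phi> \<and> surj_rel_on J \<psi> \<and> \<pi> ` I = J \<and> map_prod \<pi> \<pi> ` \<phi> = \<psi>)"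

definition plus_lift :: "index rel \<Rightarrow> index rel \<Rightarrow> bool" where
  "plus_lift \<phi>1 \<phi> \<longleftrightarrow>
     (\<exists>I1\<in>index_sets. \<exists>I\<in>index_sets. \<exists>\<pi>.
        surj_rel_on I1 \<phi>1 \<and> surj_rel_on I \<phi> \<and> \<pi> ` I1 = I \<and>
        map_prod \<pi> \<pi> ` \<phi>1 = \<phi> \<and>
        (\<exists>g. g ` I1 \<subseteq> I \<and> {(a, \<pi> b) | a b. (a, b) \<in> \<phi>1} = {(a, g a) | a. a \<in> I1}) \<and>
        (\<forall>i\<in>I. card {a \<in> I1. \<pi> a = i} > 1))"

definition condition_Gamma :: "index rel set \<Rightarrow> bool" where
  "condition_Gamma Q \<longleftrightarrow>
     Q \<noteq> {} \<and> Q \<subseteq> surj_rels \<and>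
     (\<forall>\<phi>\<in>Q. \<forall>\<psi>\<in>surj_rels. factor_of \<psi> \<phi> \<longrightarrow> \<psi> \<in> Q) \<and>
     (\<forall>\<phi>\<in>Q. \<exists>\<psi>\<in>Q. plus_lift \<psi> \<phi>)"

end

theory Submission
  imports Defs
begin

text \<open>
  The statements about \<open>Gamma_set\<close> and \<open>Gamma_star\<close> as such are those of a Galois connection. The topological content
  has three parts.
  
  Semicontinuity: on a compact space a partition cannot tell uniformly close maps apart, so the relations
  of a limit are relations of the approximating maps (\<open>Gamma_closure\<close>). Conversely, a
  relation on a fine partition determines a map up to a small error. To use this, the partition on which
  another map shows the same relation must be moved to the given one by a homeomorphism
  (\<open>partition_homeomorphism\<close>); so two conjugacy invariant sets with the same relations are dense in
  each other (\<open>Gamma_set_eq_imp_dense\<close>), and closed conjugacy invariant sets are determined by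
  their relations.
  
  Coding: given any inverse sequence of finite label sets in which every label splits, a Cantor space
  has a sequence of partitions with these labels that separates points (\<open>coding_exists\<close>). By compactness
  points correspond to threads of labels, and every partition factors through some level
  (\<open>factors_through\<close>). Homeomorphisms are obtained by matching threads, either of two codings over one tree
  or of one coding with itself after a shift of level.
  
  Realization: for a collection \<open>Q\<close> with Condition Gamma, start from \<open>\<phi> \<in> Q\<close> and lift repeatedly inside \<open>Q\<close>. Directional
  lifts only define a map on the inverse limit, but a lift has a second, shifted projection, which is
  directional for the inverse relation (\<open>plus_lift_shifted_projection\<close>). Using both projections
  alternately yields a tower that is directional to both sides, and hence a homeomorphism
  (\<open>two_sided_tower_realization\<close>). All its relations are factors of members of the tower and therefore lie in \<open>Q\<close>.
  The other half, that the relations of a set of maps satisfy Condition Gamma, comes from refining a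
  partition by its pullback along the map and halving the cells (\<open>partition_plus_lift\<close>).
\<close>

section \<open>Locally constant maps\<close>

definition locally_constant :: "('a::topological_space \<Rightarrow> 'b) \<Rightarrow> bool" where
  "locally_constant \<alpha> \<longleftrightarrow> (\<forall>S. open (\<alpha> -` S))"

lemma locally_constant_open: "locally_constant \<alpha> \<Longrightarrow> open (\<alpha> -` S)"
  by (simp add: locally_constant_def)

lemma locally_constant_closed: "locally_constant \<alpha> \<Longrightarrow> closed (\<alpha> -` S)"
  by (metis closed_open locally_constant_def vimage_Compl)

lemma locally_constantI:
  assumes "\<And>x. \<exists>V. open V \<and> x \<in> V \<and> (\<forall>y\<in>V. \<alpha> y = \<alpha> x)"
  shows "locally_constant \<alpha>"
  unfolding locally_constant_def
proof
  fix S
  show "open (\<alpha> -` S)"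
    by (subst open_subopen) (use assms in \<open>fastforce\<close>)
qed

lemma locally_constant_const: "locally_constant (\<lambda>x. c)"
  by (auto simp: locally_constant_def vimage_def)

lemma locally_constant_post: "locally_constant \<alpha> \<Longrightarrow> locally_constant (\<lambda>x. p (\<alpha> x))"
proof -
  assume "locally_constant \<alpha>"
  moreover have "(\<lambda>x. p (\<alpha> x)) -` S = \<alpha> -` (p -` S)" for S by auto
  ultimately show ?thesis by (simp add: locally_constant_def)
qed

lemma locally_constant_pre:
  assumes "locally_constant \<alpha>" "continuous_on UNIV g"
  shows "locally_constant (\<lambda>x. \<alpha> (g x))"
proof -
  have "(\<lambda>x. \<alpha> (g x)) -` S = g -` (\<alpha> -` S)" for S by auto
  then show ?thesis
    using assms by (simp add: locally_constant_def open_vimage)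
qed

lemma locally_constant_pair:
  assumes "locally_constant \<alpha>" "locally_constant \<beta>"
  shows "locally_constant (\<lambda>x. (\<alpha> x, \<beta> x))"
proof (rule locally_constantI)
  fix x
  show "\<exists>V. open V \<and> x \<in> V \<and> (\<forall>y\<in>V. (\<alpha> y, \<beta> y) = (\<alpha> x, \<beta> x))"
    by (rule exI[of _ "\<alpha> -` {\<alpha> x} \<inter> \<beta> -` {\<beta> x}"])
       (use assms in \<open>auto simp: locally_constant_open\<close>)
qed

lemma locally_constant_member:
  assumes "open U" "closed U"
  shows "locally_constant (\<lambda>x. x \<in> U)"
proof (rule locally_constantI)
  fix x
  show "\<exists>V. open V \<and> x \<in> V \<and> (\<forall>y\<in>V. (y \<in> U) = (x \<in> U))"
    by (cases "x \<in> U") (use assms in \<open>auto intro: exI[of _ U] exI[of _ "- U"]\<close>)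
qed

lemma locally_constant_If:
  assumes "open U" "closed U" "locally_constant \<alpha>" "locally_constant \<beta>"
  shows "locally_constant (\<lambda>x. if x \<in> U then \<alpha> x else \<beta> x)"
  using locally_constant_post[OF locally_constant_pair[OF locally_constant_member[OF assms(1,2)]
        locally_constant_pair[OF assms(3,4)]], of "\<lambda>(b, u, v). if b then u else v"]
  by simp

text \<open>
  Pieces chosen separately on the fibres of a locally constant map glue to a locally constant map,
  because each fibre is open.
\<close>

lemma locally_constant_diag:
  assumes "locally_constant \<alpha>" "\<And>i. i \<in> range \<alpha> \<Longrightarrow> locally_constant (\<delta> i)"
  shows "locally_constant (\<lambda>x. \<delta> (\<alpha> x) x)"
proof (rule locally_constantI)
  fix x
  show "\<exists>V. open V \<and> x \<in> V \<and> (\<forall>y\<in>V. \<delta> (\<alpha> y) y = \<delta> (\<alpha> x) x)"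
    by (rule exI[of _ "\<alpha> -` {\<alpha> x} \<inter> \<delta> (\<alpha> x) -` {\<delta> (\<alpha> x) x}"])
       (use assms in \<open>auto simp: locally_constant_open\<close>)
qed

lemma locally_constant_map:
  assumes "\<And>U. U \<in> set us \<Longrightarrow> locally_constant (c U)"
  shows "locally_constant (\<lambda>x. map (\<lambda>U. c U x) us)"
  using assms
proof (induction us)
  case Nil
  then show ?case by (simp add: locally_constant_const)
next
  case (Cons U us)
  then show ?case
    using locally_constant_post[OF locally_constant_pair[of "c U" "\<lambda>x. map (\<lambda>U. c U x) us"],
      of "\<lambda>(a, b). a # b"] by simp
qed

text \<open>
  Relations between the labels of two points are clopen in the square of the space; this turns
  statements about pairs of points into closed conditions, to which compactness applies.
\<close>

lemma closed_locally_constant_rel: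
  assumes "locally_constant \<delta>"
  shows "closed {p. R (\<delta> (fst p)) (\<delta> (snd p))}"
proof -
  have "- {p. R (\<delta> (fst p)) (\<delta> (snd p))} =
        (\<Union>(a, b) \<in> {(a, b). \<not> R a b}. \<delta> -` {a} \<times> \<delta> -` {b})" by auto
  moreover have "open \<dots>"
    by (intro open_UN) (auto intro!: open_Times locally_constant_open assms)
  ultimately show ?thesis by (simp add: closed_def)
qed

lemma compact_space_nest:
  fixes F :: "nat \<Rightarrow> 'a::topological_space set"
  assumes "compact (UNIV :: 'a set)" "\<And>n. closed (F n)" "\<And>n. F n \<noteq> {}"
    and mono: "\<And>m n. m \<le> n \<Longrightarrow> F n \<subseteq> F m"
  shows "(\<Inter>n. F n) \<noteq> {}"
proof -
  have "UNIV \<inter> (\<Inter>n\<in>UNIV. F n) \<noteq> {}"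
  proof (rule compact_imp_fip_image[OF assms(1)])
    fix N :: "nat set"
    assume "finite N"
    then have "F (Max (insert 0 N)) \<subseteq> (\<Inter>n\<in>N. F n)"
      using mono by (meson INT_greatest Max_ge finite_insert insertI2)
    then show "UNIV \<inter> (\<Inter>n\<in>N. F n) \<noteq> {}"
      using assms(3) by blast
  qed (use assms(2) in blast)
  then show ?thesis by simp
qed

lemma locally_constant_uniform:
  fixes \<alpha> :: "'a::metric_space \<Rightarrow> 'b"
  assumes "compact (UNIV :: 'a set)" "locally_constant \<alpha>"
  obtains e where "e > 0" "\<And>x y. dist x y < e \<Longrightarrow> \<alpha> x = \<alpha> y"
proof -
  obtain e where e: "e > 0" "\<And>x. \<exists>G\<in>range (\<lambda>i. \<alpha> -` {i}). ball x e \<subseteq> G"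
  proof (rule Heine_Borel_lemma[OF assms(1)])
    show "UNIV \<subseteq> \<Union> (range (\<lambda>i. \<alpha> -` {i}))" by auto
  qed (use assms(2) in \<open>auto simp: locally_constant_open\<close>)
  show thesis
  proof (rule that[OF e(1)])
    fix x y :: 'a
    assume "dist x y < e"
    then have "x \<in> ball x e" "y \<in> ball x e" using e(1) by auto
    moreover obtain i where "ball x e \<subseteq> \<alpha> -` {i}" using e(2)[of x] by auto
    ultimately have "\<alpha> x = i" "\<alpha> y = i" by blast+
    then show "\<alpha> x = \<alpha> y" by simp
  qed
qed

lemma partition_map_iff:
  "partition_map I \<alpha> \<longleftrightarrow> I \<in> index_sets \<and> locally_constant \<alpha> \<and> range \<alpha> = I"
proof -
  have "locally_constant \<alpha>" if "continuous_map euclidean (discrete_topology I) \<alpha>"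
    unfolding locally_constant_def
  proof
    fix S
    have "openin euclidean {x \<in> topspace euclidean. \<alpha> x \<in> S \<inter> I}"
      by (rule openin_continuous_map_preimage[OF that]) simp
    moreover have "\<alpha> x \<in> I" for x
      using that by (auto simp: continuous_map_def Pi_iff)
    ultimately show "open (\<alpha> -` S)" by (simp add: vimage_def)
  qed
  moreover have "continuous_map euclidean (discrete_topology I) \<alpha>"
    if "locally_constant \<alpha>" "range \<alpha> = I"
    using that by (auto simp: continuous_map_def locally_constant_def vimage_def)
  ultimately show ?thesis by (auto simp: partition_map_def)
qed

section \<open>Clopen sets and splittings of a Cantor space\<close>

lemma cantor_compact: "cantor_space (UNIV :: 'a::metric_space set) \<Longrightarrow> compact (UNIV :: 'a set)"
  by (simp add: cantor_space_def)

lemma cantor_clopen_nbhd: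
  fixes U :: "'a::metric_space set"
  assumes cs: "cantor_space (UNIV :: 'a set)" and "open U" "x \<in> U"
  obtains V where "open V" "closed V" "x \<in> V" "V \<subseteq> U"
proof -
  have "\<forall>U (x::'a). open U \<and> x \<in> U \<longrightarrow> (\<exists>V. open V \<and> closed V \<and> x \<in> V \<and> V \<subseteq> U)"
    using cs unfolding cantor_space_def zero_dimensional_def
    by (simp add: open_openin[symmetric] closed_closedin[symmetric])
  then show thesis using assms(2,3) that by blast
qed

text \<open>
  Perfectness supplies a second point in the clopen set, and zero-dimensionality a clopen neighbourhood
  of the first point that misses it.
\<close>

lemma cantor_clopen_halve:
  fixes C :: "'a::metric_space set"
  assumes cs: "cantor_space (UNIV :: 'a set)" and "open C" "closed C" "C \<noteq> {}"
  obtains V where "open V" "closed V" "V \<noteq> {}" "V \<subset> C"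
proof -
  obtain x where x: "x \<in> C" using assms by auto
  have "x islimpt UNIV" using cs by (auto simp: cantor_space_def perfect_space_def)
  then obtain y where y: "y \<in> C" "y \<noteq> x" using x \<open>open C\<close> by (meson islimptE)
  obtain V where "open V" "closed V" "x \<in> V" "V \<subseteq> C - {y}"
    using cantor_clopen_nbhd[OF cs, of "C - {y}" x] x y \<open>open C\<close> by blast
  then show thesis using that[of V] x y by blast
qed

text \<open>
  Finitely many small clopen sets cover the space. A list is used so that the vector of
  memberships of a point, read along the list, is a label of fixed length.
\<close>

lemma fine_partition:
  fixes e :: real
  assumes cs: "cantor_space (UNIV :: 'a::metric_space set)" and "e > 0"
  obtains us :: "'a::metric_space set list" where "us \<noteq> []" "\<And>U. U \<in> set us \<Longrightarrow> open U \<and> closed U"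
    "\<And>x y. (\<forall>U \<in> set us. x \<in> U \<longleftrightarrow> y \<in> U) \<Longrightarrow> dist x y < e"
proof -
  have "\<exists>V. open V \<and> closed V \<and> x \<in> V \<and> V \<subseteq> ball x (e / 2)" for x :: 'a
  proof -
    have "x \<in> ball x (e / 2)" using \<open>e > 0\<close> by simp
    then show ?thesis by (rule cantor_clopen_nbhd[OF cs open_ball]) blast
  qed
  then obtain V where V: "\<And>x::'a. open (V x) \<and> closed (V x) \<and> x \<in> V x \<and> V x \<subseteq> ball x (e / 2)"
    by metis
  obtain T :: "'a set" where T: "finite T" "UNIV \<subseteq> (\<Union>x\<in>T. V x)"
  proof (rule compactE_image[OF cantor_compact[OF cs], of UNIV V])
    show "open (V x)" for x using V by blast
    show "UNIV \<subseteq> (\<Union>x. V x)" using V by blast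
  qed
  obtain ts where ts: "set ts = T" using T(1) finite_list by blast
  show thesis
  proof (rule that[of "map V ts"])
    show "map V ts \<noteq> []" using T ts by auto
    show "open U \<and> closed U" if "U \<in> set (map V ts)" for U using that V by auto
    fix x y :: 'a
    assume *: "\<forall>U \<in> set (map V ts). x \<in> U \<longleftrightarrow> y \<in> U"
    obtain t where t: "t \<in> T" "x \<in> V t" using T by auto
    then have "y \<in> V t" using * ts by auto
    with t V[of t] have "dist t x < e / 2" "dist t y < e / 2" by auto
    then show "dist x y < e" by (metis dist_commute dist_triangle_half_r)
  qed
qed

text \<open>
  The label of a point records its memberships in a fine clopen cover, with \<open>1\<close> for yes
  and \<open>2\<close> for no, so that all entries are positive.
\<close>

lemma fine_partition_map:
  fixes e :: real
  assumes cs: "cantor_space (UNIV :: 'a::metric_space set)" and "e > 0"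
  obtains I and \<alpha> :: "'a::metric_space \<Rightarrow> index" where "partition_map I \<alpha>"
    "\<And>x y. \<alpha> x = \<alpha> y \<Longrightarrow> dist x y < e"
proof -
  obtain us :: "'a set list" where us: "us \<noteq> []" "\<And>U. U \<in> set us \<Longrightarrow> open U \<and> closed U"
    "\<And>x y. (\<forall>U \<in> set us. x \<in> U \<longleftrightarrow> y \<in> U) \<Longrightarrow> dist x y < e"
    using fine_partition[OF assms] by blast
  define \<alpha> :: "'a \<Rightarrow> index" where "\<alpha> = (\<lambda>x. map (\<lambda>U. if x \<in> U then 1 else 2) us)"
  have lc: "locally_constant \<alpha>"
    unfolding \<alpha>_def by (intro locally_constant_map locally_constant_If locally_constant_const)
      (use us in auto)
  have "range \<alpha> \<subseteq> {xs. set xs \<subseteq> {1, 2} \<and> length xs = length us}"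
    by (auto simp: \<alpha>_def)
  moreover have "finite {xs::nat list. set xs \<subseteq> {1, 2} \<and> length xs = length us}"
    by (rule finite_lists_length_eq) simp
  ultimately have "finite (range \<alpha>)" by (rule finite_subset)
  moreover have "\<exists>n\<ge>1. range \<alpha> \<subseteq> {xs. length xs = n \<and> (\<forall>k\<in>set xs. k \<ge> 1)}"
    using us(1) by (intro exI[of _ "length us"]) (auto simp: \<alpha>_def Suc_le_eq)
  ultimately have "partition_map (range \<alpha>) \<alpha>"
    using lc by (simp add: partition_map_iff index_sets_def)
  moreover have "dist x y < e" if "\<alpha> x = \<alpha> y" for x y
  proof (rule us(3), rule ballI)
    fix U assume "U \<in> set us"
    then have "(if x \<in> U then 1 else 2 :: nat) = (if y \<in> U then 1 else 2)"
      using that by (simp add: \<alpha>_def)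
    then show "x \<in> U \<longleftrightarrow> y \<in> U" by (simp split: if_splits)
  qed
  ultimately show thesis using that by blast
qed

lemma separating_clopen_sequence:
  assumes cs: "cantor_space (UNIV :: 'a::metric_space set)"
  obtains U :: "nat \<Rightarrow> 'a::metric_space set" where "\<And>k. open (U k) \<and> closed (U k)"
    "\<And>x y. (\<And>k. x \<in> U k \<longleftrightarrow> y \<in> U k) \<Longrightarrow> x = y"
proof -
  have "\<exists>us::'a set list. us \<noteq> [] \<and> (\<forall>U \<in> set us. open U \<and> closed U) \<and>
     (\<forall>x y. (\<forall>U \<in> set us. x \<in> U \<longleftrightarrow> y \<in> U) \<longrightarrow> dist x y < inverse (Suc n))" for n
  proof (rule fine_partition[OF cs])
    show "inverse (real (Suc n)) > 0" by simp
  qed blast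
  then obtain us :: "nat \<Rightarrow> 'a set list" where us: "\<And>n. us n \<noteq> []"
    "\<And>n. \<forall>U \<in> set (us n). open U \<and> closed U"
    "\<And>n x y. (\<forall>U \<in> set (us n). x \<in> U \<longleftrightarrow> y \<in> U) \<Longrightarrow> dist x y < inverse (Suc n)"
    by metis
  define W where "W = (\<Union>n. set (us n))"
  have W: "countable W" "W \<noteq> {}"
    using us(1) by (auto simp: W_def countable_finite)
  have rng: "range (from_nat_into W) = W" by (rule range_from_nat_into[OF W(2,1)])
  show thesis
  proof (rule that[of "from_nat_into W"])
    show "open (from_nat_into W k) \<and> closed (from_nat_into W k)" for k
      using from_nat_into[OF W(2), of k] us(2) by (auto simp: W_def)
    fix x y
    assume "\<And>k. x \<in> from_nat_into W k \<longleftrightarrow> y \<in> from_nat_into W k"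
    then have *: "x \<in> U \<longleftrightarrow> y \<in> U" if "U \<in> W" for U using that rng by (metis imageE)
    have "dist x y < inverse (Suc n)" for n
      by (rule us(3)) (use * in \<open>auto simp: W_def\<close>)
    then show "x = y"
      by (metis less_asym' reals_Archimedean zero_less_dist_iff)
  qed
qed

lemma clopen_split:
  assumes cs: "cantor_space (UNIV :: 'a::metric_space set)"
    and "finite J" "J \<noteq> {}" "open (C :: 'a::metric_space set)" "closed C" "C \<noteq> {}"
  shows "\<exists>\<delta>. locally_constant \<delta> \<and> \<delta> ` C = J"
  using assms(2-)
proof (induction J arbitrary: C rule: finite_ne_induct)
  case (singleton j)
  then show ?case by (intro exI[of _ "\<lambda>x. j"]) (auto simp: locally_constant_const)
next
  case (insert j J)
  obtain V where V: "open V" "closed V" "V \<noteq> {}" "V \<subset> C"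
    using cantor_clopen_halve[OF cs] insert.prems by metis
  then obtain \<delta> where \<delta>: "locally_constant \<delta>" "\<delta> ` V = J"
    using insert.IH by blast
  show ?case
  proof (intro exI[of _ "\<lambda>x. if x \<in> V then \<delta> x else j"] conjI)
    show "locally_constant (\<lambda>x. if x \<in> V then \<delta> x else j)"
      by (intro locally_constant_If V \<delta> locally_constant_const)
    show "(\<lambda>x. if x \<in> V then \<delta> x else j) ` C = insert j J"
      using V(4) \<delta>(2) by (force simp: image_iff)
  qed
qed

text \<open>
  At least two labels are available, so if \<open>U\<close> cuts \<open>C\<close> properly, then one label can be reserved for the points
  of \<open>C\<close> inside \<open>U\<close> and the others used outside. This is what later forces prescribed splittings to separate points: the
  number of pieces is given, but the places where to cut are free.
\<close>

lemma clopen_split_along: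
  assumes cs: "cantor_space (UNIV :: 'a::metric_space set)"
    and J: "card J > 1" and C: "open (C :: 'a::metric_space set)" "closed C" "C \<noteq> {}"
    and U: "open U" "closed U"
  shows "\<exists>\<delta>. locally_constant \<delta> \<and> \<delta> ` C = J \<and>
    (\<forall>x\<in>C. \<forall>y\<in>C. \<delta> x = \<delta> y \<longrightarrow> (x \<in> U \<longleftrightarrow> y \<in> U))"
proof (cases "C \<inter> U = {} \<or> C \<subseteq> U")
  case True
  have "finite J" "J \<noteq> {}" using J by (auto intro: card_ge_0_finite)
  then obtain \<delta> where "locally_constant \<delta>" "\<delta> ` C = J"
    using clopen_split[OF cs _ _ C] by blast
  then show ?thesis using True by blast
next
  case False
  have fin: "finite J" "J \<noteq> {}" using J by (auto intro: card_ge_0_finite)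
  then obtain j where j: "j \<in> J" by auto
  have ne: "J - {j} \<noteq> {}"
  proof
    assume "J - {j} = {}"
    then have "J = {j}" using j by blast
    then show False using J by simp
  qed
  obtain \<delta> where \<delta>: "locally_constant \<delta>" "\<delta> ` (C - U) = J - {j}"
    using clopen_split[OF cs _ ne, of "C - U"] fin C U False
    by (auto simp: open_Diff closed_Diff)
  show ?thesis
  proof (intro exI[of _ "\<lambda>x. if x \<in> U then j else \<delta> x"] conjI ballI impI)
    show "locally_constant (\<lambda>x. if x \<in> U then j else \<delta> x)"
      by (intro locally_constant_If U \<delta> locally_constant_const)
    show "(\<lambda>x. if x \<in> U then j else \<delta> x) ` C = J"
    proof -
      have "(\<lambda>x. if x \<in> U then j else \<delta> x) ` C = (\<lambda>x. j) ` (C \<inter> U) \<union> \<delta> ` (C - U)"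
        by (auto simp: image_iff)
      then show ?thesis using \<delta>(2) False j by auto
    qed
    fix x y
    assume "x \<in> C" "y \<in> C" "(if x \<in> U then j else \<delta> x) = (if y \<in> U then j else \<delta> y)"
    moreover have "\<delta> z \<noteq> j" if "z \<in> C" "z \<notin> U" for z using that \<delta>(2) by blast
    ultimately show "x \<in> U \<longleftrightarrow> y \<in> U"
      by (cases "x \<in> U"; cases "y \<in> U") (simp_all, metis)
  qed
qed

lemma refine_labelling:
  fixes \<alpha> :: "'a::metric_space \<Rightarrow> 'i" and \<rho> :: "'j \<Rightarrow> 'i"
  assumes cs: "cantor_space (UNIV :: 'a set)"
    and \<alpha>: "locally_constant \<alpha>" "range \<alpha> = I"
    and \<rho>: "\<rho> ` J = I" "\<And>i. i \<in> I \<Longrightarrow> card {j \<in> J. \<rho> j = i} > 1"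
    and U: "open U" "closed U"
  shows "\<exists>\<beta>. locally_constant \<beta> \<and> range \<beta> = J \<and> (\<forall>x. \<rho> (\<beta> x) = \<alpha> x) \<and>
    (\<forall>x y. \<beta> x = \<beta> y \<longrightarrow> (x \<in> U \<longleftrightarrow> y \<in> U))"
proof -
  have ex: "\<exists>\<delta>. locally_constant \<delta> \<and> \<delta> ` (\<alpha> -` {i}) = {j \<in> J. \<rho> j = i} \<and>
    (\<forall>x \<in> \<alpha> -` {i}. \<forall>y \<in> \<alpha> -` {i}. \<delta> x = \<delta> y \<longrightarrow> (x \<in> U \<longleftrightarrow> y \<in> U))" if "i \<in> I" for i
  proof -
    have "\<alpha> -` {i} \<noteq> {}" using that \<alpha>(2) by blast
    then show ?thesis
      by (rule clopen_split_along[OF cs \<rho>(2)[OF that] locally_constant_open[OF \<alpha>(1)]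
          locally_constant_closed[OF \<alpha>(1)] _ U])
  qed
  have "\<exists>\<delta>. \<forall>i\<in>I. locally_constant (\<delta> i) \<and> \<delta> i ` (\<alpha> -` {i}) = {j \<in> J. \<rho> j = i} \<and>
    (\<forall>x \<in> \<alpha> -` {i}. \<forall>y \<in> \<alpha> -` {i}. \<delta> i x = \<delta> i y \<longrightarrow> (x \<in> U \<longleftrightarrow> y \<in> U))"
    by (rule bchoice) (use ex in blast)
  then obtain \<delta> where \<delta>_all: "\<forall>i\<in>I. locally_constant (\<delta> i) \<and>
    \<delta> i ` (\<alpha> -` {i}) = {j \<in> J. \<rho> j = i} \<and>
    (\<forall>x \<in> \<alpha> -` {i}. \<forall>y \<in> \<alpha> -` {i}. \<delta> i x = \<delta> i y \<longrightarrow> (x \<in> U \<longleftrightarrow> y \<in> U))" ..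
  then have \<delta>: "\<And>i. i \<in> I \<Longrightarrow> locally_constant (\<delta> i)"
    "\<And>i. i \<in> I \<Longrightarrow> \<delta> i ` (\<alpha> -` {i}) = {j \<in> J. \<rho> j = i}"
    by simp_all
  have \<delta>_sep: "x \<in> U \<longleftrightarrow> y \<in> U" if "i \<in> I" "\<alpha> x = i" "\<alpha> y = i" "\<delta> i x = \<delta> i y" for i x y
    using bspec[OF \<delta>_all that(1)] that(2-) by blast
  define \<beta> where "\<beta> = (\<lambda>x. \<delta> (\<alpha> x) x)"
  have in_I: "\<alpha> x \<in> I" for x using \<alpha>(2) by auto
  have \<beta>: "\<beta> x \<in> J" "\<rho> (\<beta> x) = \<alpha> x" for x
  proof -
    have "\<beta> x \<in> \<delta> (\<alpha> x) ` (\<alpha> -` {\<alpha> x})" by (simp add: \<beta>_def)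
    then show "\<beta> x \<in> J" "\<rho> (\<beta> x) = \<alpha> x" by (simp_all add: \<delta>(2)[OF in_I])
  qed
  have "J \<subseteq> range \<beta>"
  proof
    fix j assume "j \<in> J"
    then have "\<rho> j \<in> I" using \<rho>(1) by auto
    then have "j \<in> \<delta> (\<rho> j) ` (\<alpha> -` {\<rho> j})" using \<open>j \<in> J\<close> by (simp add: \<delta>(2))
    then obtain x where "j = \<delta> (\<rho> j) x" "\<alpha> x = \<rho> j" by blast
    then have "j = \<beta> x" by (simp add: \<beta>_def)
    then show "j \<in> range \<beta>" by blast
  qed
  then have "range \<beta> = J" using \<beta>(1) by auto
  moreover have "locally_constant \<beta>"
    unfolding \<beta>_def by (rule locally_constant_diag[OF \<alpha>(1)]) (simp add: \<alpha>(2) \<delta>(1))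
  moreover have "x \<in> U \<longleftrightarrow> y \<in> U" if "\<beta> x = \<beta> y" for x y
  proof -
    have "\<alpha> x = \<alpha> y" using that \<beta>(2) by metis
    moreover from this have "\<delta> (\<alpha> x) x = \<delta> (\<alpha> x) y" using that by (simp add: \<beta>_def)
    ultimately show ?thesis using \<delta>_sep[OF in_I refl] by metis
  qed
  ultimately show ?thesis using \<beta>(2) by blast
qed

section \<open>Coding a Cantor space by a tree of partitions\<close>

text \<open>
  An inverse sequence of label sets in which every label splits into at least two labels on the next
  level. The level sets are allowed to be carriers in one type, so that the sequence can be built
  by recursion.
\<close>

locale splitting_system =
  fixes I :: "nat \<Rightarrow> 'i set" and \<rho> :: "nat \<Rightarrow> 'i \<Rightarrow> 'i"
  assumes surj: "\<rho> k ` I (Suc k) = I k"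
    and split: "i \<in> I k \<Longrightarrow> card {j \<in> I (Suc k). \<rho> k j = i} > 1"

text \<open>
  A sequence of successively finer labellings that separates points, that is, an identification of the
  space with the inverse limit of the label sets.
\<close>

locale cantor_coding =
  fixes I :: "nat \<Rightarrow> 'i set" and \<rho> :: "nat \<Rightarrow> 'i \<Rightarrow> 'i"
    and \<alpha> :: "nat \<Rightarrow> 'a::metric_space \<Rightarrow> 'i"
  assumes cantor: "cantor_space (UNIV :: 'a set)"
    and lc: "locally_constant (\<alpha> k)"
    and range: "range (\<alpha> k) = I k"
    and compat: "\<rho> k (\<alpha> (Suc k) x) = \<alpha> k x"
    and separating: "(\<And>k. \<alpha> k x = \<alpha> k y) \<Longrightarrow> x = y"

text \<open>
  The \<open>k\<close>-th refinement is cut along the \<open>k\<close>-th member of a countable point-separating family of clopen sets.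
  Thus the labellings separate points although the combinatorics of the tree was given
  beforehand.
\<close>

lemma (in splitting_system) coding_exists:
  fixes \<alpha>0 :: "'a::metric_space \<Rightarrow> 'i"
  assumes cs: "cantor_space (UNIV :: 'a set)"
    and "locally_constant \<alpha>0" "range \<alpha>0 = I 0"
  obtains \<alpha> where "cantor_coding I \<rho> \<alpha>" "\<alpha> 0 = \<alpha>0"
proof -
  obtain U :: "nat \<Rightarrow> 'a set" where U: "\<And>k. open (U k) \<and> closed (U k)"
    "\<And>x y. (\<And>k. x \<in> U k \<longleftrightarrow> y \<in> U k) \<Longrightarrow> x = y"
    using separating_clopen_sequence[OF cs] by blast
  have "\<exists>\<alpha>. \<forall>k. (locally_constant (\<alpha> k) \<and> range (\<alpha> k) = I k \<and> (k = 0 \<longrightarrow> \<alpha> k = \<alpha>0)) \<and>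
    ((\<forall>x. \<rho> k (\<alpha> (Suc k) x) = \<alpha> k x) \<and>
     (\<forall>x y. \<alpha> (Suc k) x = \<alpha> (Suc k) y \<longrightarrow> (x \<in> U k \<longleftrightarrow> y \<in> U k)))"
  proof (rule dependent_nat_choice)
    show "\<exists>\<alpha>. locally_constant \<alpha> \<and> range \<alpha> = I 0 \<and> (0 = 0 \<longrightarrow> \<alpha> = \<alpha>0)"
      using assms by auto
    fix \<alpha> k
    assume "locally_constant \<alpha> \<and> range \<alpha> = I k \<and> (k = 0 \<longrightarrow> \<alpha> = \<alpha>0)"
    then show "\<exists>\<beta>. (locally_constant \<beta> \<and> range \<beta> = I (Suc k) \<and> (Suc k = 0 \<longrightarrow> \<beta> = \<alpha>0)) \<and>
      (\<forall>x. \<rho> k (\<beta> x) = \<alpha> x) \<and> (\<forall>x y. \<beta> x = \<beta> y \<longrightarrow> (x \<in> U k \<longleftrightarrow> y \<in> U k))"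
      using refine_labelling[OF cs, of \<alpha> "I k" "\<rho> k" "I (Suc k)" "U k"] surj split U(1)
      by simp
  qed
  then obtain \<alpha> where \<alpha>: "\<And>k. locally_constant (\<alpha> k)" "\<And>k. range (\<alpha> k) = I k" "\<alpha> 0 = \<alpha>0"
    "\<And>k x. \<rho> k (\<alpha> (Suc k) x) = \<alpha> k x"
    "\<And>k x y. \<alpha> (Suc k) x = \<alpha> (Suc k) y \<Longrightarrow> x \<in> U k \<longleftrightarrow> y \<in> U k"
    by (simp only: all_conj_distrib) blast
  have "cantor_coding I \<rho> \<alpha>"
  proof
    fix x y
    assume "\<And>k. \<alpha> k x = \<alpha> k y"
    then show "x = y" by (intro U(2) \<alpha>(5))
  qed (rule cs \<alpha>)+
  then show thesis using \<alpha>(3) that by blast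
qed

context cantor_coding
begin

lemma coarser:
  assumes "\<alpha> n x = \<alpha> n y" "m \<le> n"
  shows "\<alpha> m x = \<alpha> m y"
  using assms(2,1)
proof (induction rule: dec_induct)
  case (step n)
  have "\<alpha> n x = \<rho> n (\<alpha> (Suc n) x)" by (simp add: compat)
  also have "\<dots> = \<rho> n (\<alpha> (Suc n) y)" using step.prems by simp
  also have "\<dots> = \<alpha> n y" by (rule compat)
  finally show ?case by (rule step.IH)
qed

text \<open>
  Surjectivity of the coding onto the inverse limit: the fibres along a thread are nested nonempty
  compact sets.
\<close>

lemma thread_point:
  assumes "\<And>k. i k \<in> I k" "\<And>k. \<rho> k (i (Suc k)) = i k"
  obtains x where "\<And>k. \<alpha> k x = i k"
proof -
  have sub: "\<alpha> n -` {i n} \<subseteq> \<alpha> m -` {i m}" if "m \<le> n" for m n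
    using that
  proof (induction rule: dec_induct)
    case (step n)
    have "\<alpha> (Suc n) -` {i (Suc n)} \<subseteq> \<alpha> n -` {i n}"
    proof
      fix x assume "x \<in> \<alpha> (Suc n) -` {i (Suc n)}"
      then have "\<rho> n (\<alpha> (Suc n) x) = i n" by (simp add: assms(2))
      then show "x \<in> \<alpha> n -` {i n}" by (simp add: compat)
    qed
    then show ?case using step.IH by blast
  qed simp
  have "(\<Inter>k. \<alpha> k -` {i k}) \<noteq> {}"
  proof (rule compact_space_nest[OF cantor_compact[OF cantor]])
    show "closed (\<alpha> k -` {i k})" for k
      by (rule locally_constant_closed[OF lc])
    show "\<alpha> k -` {i k} \<noteq> {}" for k
    proof -
      obtain x where "\<alpha> k x = i k" using assms(1)[of k] range[of k] by (metis imageE)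
      then show ?thesis by (metis empty_iff vimage_singleton_eq)
    qed
    show "\<alpha> n -` {i n} \<subseteq> \<alpha> m -` {i m}" if "m \<le> n" for m n
      using that by (rule sub)
  qed
  then obtain x where "x \<in> (\<Inter>k. \<alpha> k -` {i k})" by blast
  then have "\<alpha> k x = i k" for k by simp
  then show thesis by (rule that)
qed

text \<open>
  The pairs that \<open>\<alpha> k\<close> identifies and \<open>\<gamma>\<close> distinguishes form a decreasing sequence of closed sets. A
  common element of all of them would be a pair of distinct points that the coding does not
  separate, so by compactness some member of the sequence is empty.
\<close>

lemma factors_through:
  assumes "locally_constant \<gamma>"
  obtains k where "\<And>x y. \<alpha> k x = \<alpha> k y \<Longrightarrow> \<gamma> x = \<gamma> y"
proof (rule ccontr)
  assume neg: "\<not> thesis"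
  define D where "D = (\<lambda>k. {p. \<alpha> k (fst p) = \<alpha> k (snd p) \<and> \<gamma> (fst p) \<noteq> \<gamma> (snd p)})"
  have "(\<Inter>k. D k) \<noteq> {}"
  proof (rule compact_space_nest)
    show "compact (UNIV :: ('a \<times> 'a) set)"
      using compact_Times[OF cantor_compact[OF cantor] cantor_compact[OF cantor]] by simp
    fix k
    show "closed (D k)"
      using closed_locally_constant_rel[OF locally_constant_pair[OF lc[of k] assms],
        of "\<lambda>(a, b) (c, d). a = c \<and> b \<noteq> d"] by (simp add: D_def)
    show "D k \<noteq> {}" using neg that[of k] by (auto simp: D_def)
  next
    fix m n :: nat
    assume "m \<le> n"
    then show "D n \<subseteq> D m"
      unfolding D_def by (intro Collect_mono impI conjI; elim conjE) (rule coarser, assumption+)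
  qed
  then obtain p where "p \<in> (\<Inter>k. D k)" by blast
  then have "\<alpha> k (fst p) = \<alpha> k (snd p)" "\<gamma> (fst p) \<noteq> \<gamma> (snd p)" for k
    by (simp_all add: D_def)
  then show False using separating by metis
qed

lemma continuous_if_coded:
  fixes g :: "'b::metric_space \<Rightarrow> 'a"
  assumes "\<And>k. locally_constant (\<lambda>x. \<alpha> k (g x))"
  shows "continuous_on UNIV g"
  unfolding continuous_on_iff
proof (intro ballI allI impI)
  fix x and e :: real
  assume "e > 0"
  obtain J and \<gamma> :: "'a \<Rightarrow> index" where \<gamma>: "partition_map J \<gamma>"
    "\<And>x y. \<gamma> x = \<gamma> y \<Longrightarrow> dist x y < e"
    using fine_partition_map[OF cantor \<open>e > 0\<close>] by blast
  obtain k where k: "\<And>x y. \<alpha> k x = \<alpha> k y \<Longrightarrow> \<gamma> x = \<gamma> y"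
    using factors_through \<gamma>(1) by (metis partition_map_iff)
  have "open ((\<lambda>x. \<alpha> k (g x)) -` {\<alpha> k (g x)})" by (rule locally_constant_open[OF assms])
  then obtain d where "d > 0" "\<And>y. dist y x < d \<Longrightarrow> \<alpha> k (g y) = \<alpha> k (g x)"
    by (auto simp: open_dist)
  then show "\<exists>d>0. \<forall>y\<in>UNIV. dist y x < d \<longrightarrow> dist (g y) (g x) < e"
    using \<gamma>(2) k by blast
qed

end

section \<open>Homeomorphisms with prescribed action on a partition\<close>

text \<open>
  Two codings over the same tree identify both spaces with the same inverse limit; matching the
  points with equal threads is a homeomorphism.
\<close>

lemma coding_homeomorphism:
  assumes "cantor_coding I \<rho> \<alpha>" "cantor_coding I \<rho> \<beta>"
  obtains h h' where "homeomorphism UNIV UNIV h h'" "\<And>k x. \<alpha> k (h x) = \<beta> k x"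
proof -
  interpret A: cantor_coding I \<rho> \<alpha> by fact
  interpret B: cantor_coding I \<rho> \<beta> by fact
  have "\<exists>y. \<forall>k. \<alpha> k y = \<beta> k x" for x
    by (rule A.thread_point[of "\<lambda>k. \<beta> k x"]) (use B.range B.compat in auto)
  then obtain h where h: "\<And>k x. \<alpha> k (h x) = \<beta> k x" by metis
  have "\<exists>x. \<forall>k. \<beta> k x = \<alpha> k y" for y
    by (rule B.thread_point[of "\<lambda>k. \<alpha> k y"]) (use A.range A.compat in auto)
  then obtain h' where h': "\<And>k y. \<beta> k (h' y) = \<alpha> k y" by metis
  have "continuous_on UNIV h"
    by (rule A.continuous_if_coded) (simp add: h B.lc)
  moreover have "continuous_on UNIV h'"
    by (rule B.continuous_if_coded) (simp add: h' A.lc)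
  moreover have "h' (h x) = x" for x by (rule B.separating) (simp add: h h')
  moreover have "h (h' y) = y" for y by (rule A.separating) (simp add: h h')
  ultimately have "homeomorphism UNIV UNIV h h'"
    by (auto intro!: homeomorphismI)
  then show thesis using h that by blast
qed

text \<open>
  This contains the fact that any two nonempty proper clopen subsets of a Cantor space are homeomorphic. Both
  partitions are continued to codings over the same tree, in which every cell is halved at every step:
  a label of level \<open>k\<close> is a cell together with \<open>k\<close> binary choices, the latest one first.
\<close>

lemma partition_homeomorphism:
  fixes \<alpha> \<beta> :: "'a::metric_space \<Rightarrow> 'i"
  assumes cs: "cantor_space (UNIV :: 'a set)"
    and \<alpha>: "locally_constant \<alpha>" and \<beta>: "locally_constant \<beta>" and "range \<alpha> = range \<beta>"
  obtains h h' where "homeomorphism UNIV UNIV h h'" "\<And>x. \<alpha> (h x) = \<beta> x"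
proof -
  define I where "I = (\<lambda>k. range \<alpha> \<times> {bs :: bool list. length bs = k})"
  define \<rho> :: "nat \<Rightarrow> 'i \<times> bool list \<Rightarrow> 'i \<times> bool list" where "\<rho> = (\<lambda>k. apsnd tl)"
  interpret splitting_system I \<rho>
  proof
    fix k
    show "\<rho> k ` I (Suc k) = I k"
    proof
      show "I k \<subseteq> \<rho> k ` I (Suc k)"
      proof
        fix p assume "p \<in> I k"
        then have "(fst p, True # snd p) \<in> I (Suc k)" "\<rho> k (fst p, True # snd p) = p"
          by (auto simp: I_def \<rho>_def)
        then show "p \<in> \<rho> k ` I (Suc k)" by (metis imageI)
      qed
    qed (auto simp: I_def \<rho>_def)
    fix i assume i: "i \<in> I k"
    then obtain c bs where c: "i = (c, bs)" "c \<in> range \<alpha>" "length bs = k"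
      unfolding I_def by blast
    have "j \<in> {j \<in> I (Suc k). \<rho> k j = i} \<longleftrightarrow> j \<in> {(c, True # bs), (c, False # bs)}" for j
    proof -
      obtain d cs where j: "j = (d, cs)" by fastforce
      show ?thesis
        unfolding j I_def \<rho>_def c(1) using c(2,3) by (cases cs) (simp_all, blast)
    qed
    then have "{j \<in> I (Suc k). \<rho> k j = i} = {(c, True # bs), (c, False # bs)}"
      by (rule set_eqI)
    then show "card {j \<in> I (Suc k). \<rho> k j = i} > 1" by simp
  qed
  have start: "locally_constant (\<lambda>x. (\<gamma> x, [] :: bool list))" "range (\<lambda>x. (\<gamma> x, [])) = I 0"
    if "locally_constant \<gamma>" "range \<gamma> = range \<alpha>" for \<gamma>
    using that by (auto simp: I_def intro: locally_constant_pair locally_constant_const)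
  obtain A where A: "cantor_coding I \<rho> A" "A 0 = (\<lambda>x. (\<alpha> x, []))"
    using coding_exists[OF cs start[OF \<alpha> refl]] by blast
  obtain B where B: "cantor_coding I \<rho> B" "B 0 = (\<lambda>x. (\<beta> x, []))"
    using coding_exists[OF cs start[OF \<beta> assms(4)[symmetric]]] by blast
  obtain h h' where h: "homeomorphism UNIV UNIV h h'" "\<And>k x. A k (h x) = B k x"
    using coding_homeomorphism[OF A(1) B(1)] by blast
  have "\<alpha> (h x) = \<beta> x" for x using h(2)[of 0 x] A(2) B(2) by simp
  then show thesis using h(1) that by blast
qed

section \<open>Relations induced on partitions\<close>

lemma surj_rel_on_domain: "surj_rel_on I \<phi> \<Longrightarrow> fst ` \<phi> = I"
  by (simp add: surj_rel_on_def)

lemma surj_rel_on_range: "surj_rel_on I \<phi> \<Longrightarrow> snd ` \<phi> = I"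
  by (simp add: surj_rel_on_def)

lemma image_rel_eq_image: "image_rel f \<alpha> = range (\<lambda>x. (\<alpha> x, \<alpha> (apply_bcontfun f x)))"
  by (auto simp: image_rel_def)

lemma fst_image_rel: "fst ` image_rel f \<alpha> = range \<alpha>"
  by (simp add: image_rel_eq_image image_image)

lemma snd_image_rel: "f \<in> Cs \<Longrightarrow> snd ` image_rel f \<alpha> = range \<alpha>"
  by (simp add: image_rel_eq_image image_image Cs_def flip: image_image[of \<alpha> "apply_bcontfun f"])

lemma image_rel_post: "map_prod \<pi> \<pi> ` image_rel f \<alpha> = image_rel f (\<lambda>x. \<pi> (\<alpha> x))"
  by (simp add: image_rel_eq_image image_image)

lemma surj_rel_on_image_rel:
  assumes "f \<in> Cs" "partition_map I \<alpha>"
  shows "surj_rel_on I (image_rel f \<alpha>)"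
proof -
  have "range \<alpha> = I" using assms(2) by (simp add: partition_map_iff)
  moreover from this have "image_rel f \<alpha> \<subseteq> I \<times> I" unfolding image_rel_def by blast
  ultimately show ?thesis
    using assms(1) by (simp add: surj_rel_on_def fst_image_rel snd_image_rel)
qed

lemma image_rel_in_Gamma:
  assumes "f \<in> Cs" "partition_map I \<alpha>"
  shows "image_rel f \<alpha> \<in> Gamma f"
  using assms surj_rel_on_image_rel[OF assms]
  by (auto simp: Gamma_def surj_rels_def partition_map_iff)

lemma Gamma_image_rel:
  assumes "\<phi> \<in> Gamma f"
  obtains I \<alpha> where "partition_map I \<alpha>" "\<phi> = image_rel f \<alpha>" "\<phi> \<in> surj_rels"
  using assms by (auto simp: Gamma_def)

lemma GammaI: "partition_map I \<alpha> \<Longrightarrow> \<phi> = image_rel f \<alpha> \<Longrightarrow> \<phi> \<in> surj_rels \<Longrightarrow> \<phi> \<in> Gamma f"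
  unfolding Gamma_def by blast

lemma Gamma_set_mono: "K \<subseteq> L \<Longrightarrow> Gamma_set K \<subseteq> Gamma_set L"
  by (auto simp: Gamma_set_def)

lemma Gamma_set_Gamma_star: "Gamma_set (Gamma_star Q) \<subseteq> Q"
  by (auto simp: Gamma_set_def Gamma_star_def)

lemma subset_Gamma_star: "K \<subseteq> Cs \<Longrightarrow> K \<subseteq> Gamma_star (Gamma_set K)"
  by (auto simp: Gamma_set_def Gamma_star_def)

text \<open>
  The cells of a partition of a compact space have positive distance from each other, so
  a small perturbation of \<open>f\<close> sends every point to the same cell.
\<close>

lemma image_rel_stable:
  assumes "compact (UNIV :: 'a::metric_space set)" "locally_constant \<alpha>"
  obtains e where "e > 0"
    "\<And>f g :: 'a \<Rightarrow>\<^sub>C 'a. dist f g < e \<Longrightarrow> image_rel f \<alpha> = image_rel g \<alpha>"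
proof -
  obtain e where e: "e > 0" "\<And>x y. dist x y < e \<Longrightarrow> \<alpha> x = \<alpha> y"
    using locally_constant_uniform[OF assms] by blast
  show thesis
  proof (rule that[OF e(1)])
    fix f g :: "'a \<Rightarrow>\<^sub>C 'a"
    assume "dist f g < e"
    then have "\<alpha> (apply_bcontfun f x) = \<alpha> (apply_bcontfun g x)" for x
      by (intro e(2) le_less_trans[OF dist_bounded])
    then show "image_rel f \<alpha> = image_rel g \<alpha>" by (simp add: image_rel_eq_image)
  qed
qed

text \<open>
  A partition shows the same relation for \<open>f\<close> and for any sufficiently close member of \<open>K\<close>. Both the closedness of \<open>Gamma_star Q\<close> and the equality
  of \<open>Gamma_set\<close> on a dense subset are instances of this.
\<close>

lemma Gamma_closure:
  fixes f :: "'a::metric_space \<Rightarrow>\<^sub>C 'a"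
  assumes "compact (UNIV :: 'a set)" "f \<in> closure K"
  shows "Gamma f \<subseteq> Gamma_set K"
proof
  fix \<phi> assume "\<phi> \<in> Gamma f"
  then obtain I \<alpha> where \<alpha>: "partition_map I \<alpha>" "\<phi> = image_rel f \<alpha>" "\<phi> \<in> surj_rels"
    by (rule Gamma_image_rel)
  have "locally_constant \<alpha>" using \<alpha>(1) by (simp add: partition_map_iff)
  then obtain e where e: "e > 0"
    "\<And>f g :: 'a \<Rightarrow>\<^sub>C 'a. dist f g < e \<Longrightarrow> image_rel f \<alpha> = image_rel g \<alpha>"
    using image_rel_stable[OF assms(1)] by blast
  obtain g where g: "g \<in> K" "dist g f < e"
    using assms(2) e(1) by (auto simp: closure_approachable)
  have "\<phi> = image_rel g \<alpha>" using e(2)[OF g(2)] \<alpha>(2) by simp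
  then have "\<phi> \<in> Gamma g" by (rule GammaI[OF \<alpha>(1) _ \<alpha>(3)])
  then show "\<phi> \<in> Gamma_set K" using g(1) by (auto simp: Gamma_set_def)
qed

lemma closedin_Gamma_star:
  assumes "compact (UNIV :: 'a::metric_space set)"
  shows "closedin (top_of_set Cs) (Gamma_star Q :: ('a \<Rightarrow>\<^sub>C 'a) set)"
proof -
  have "f \<in> Gamma_star Q" if "f \<in> Cs" "f \<in> closure (Gamma_star Q)" for f :: "'a \<Rightarrow>\<^sub>C 'a"
    using Gamma_closure[OF assms that(2)] Gamma_set_Gamma_star[of Q] that(1)
    unfolding Gamma_star_def by blast
  moreover have "Gamma_star Q \<subseteq> (Cs :: ('a \<Rightarrow>\<^sub>C 'a) set)" by (auto simp: Gamma_star_def)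
  ultimately have "Gamma_star Q = Cs \<inter> closure (Gamma_star Q :: ('a \<Rightarrow>\<^sub>C 'a) set)"
    using closure_subset[of "Gamma_star Q"] by blast
  then show ?thesis by (metis closed_closure closedin_closed)
qed

lemma conjugate_Cs:
  fixes f :: "'a::metric_space \<Rightarrow>\<^sub>C 'a"
  assumes "compact (UNIV :: 'a set)" "h \<in> Homeo" "f \<in> Cs"
  shows "conjugate h f \<in> Cs"
proof -
  have "surj (apply_bcontfun h)" "surj (inv (apply_bcontfun h))"
    using Homeo_inv[OF assms(2)] by (simp_all add: homeomorphism_def)
  then have "surj (apply_bcontfun h \<circ> apply_bcontfun f \<circ> inv (apply_bcontfun h))"
    using assms(3) by (intro comp_surj) (simp_all add: Cs_def)
  then show ?thesis by (simp add: Cs_def apply_conjugate[OF assms(1,2)])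
qed

lemma image_rel_conjugate:
  fixes f :: "'a::metric_space \<Rightarrow>\<^sub>C 'a" and \<alpha> :: "'a \<Rightarrow> index"
  assumes "compact (UNIV :: 'a set)" "h \<in> Homeo"
  shows "image_rel (conjugate h f) \<alpha> = image_rel f (\<lambda>x. \<alpha> (apply_bcontfun h x))"
proof -
  let ?h = "apply_bcontfun h"
  have h: "homeomorphism UNIV UNIV ?h (inv ?h)" by (rule Homeo_inv[OF assms(2)])
  then have range_h: "range ?h = UNIV" and inv_h: "inv ?h (?h x) = x" for x
    by (simp_all add: homeomorphism_def)
  have "range c = range (\<lambda>x. c (?h x))" for c :: "'a \<Rightarrow> index \<times> index"
    using range_h by (metis image_image)
  from this[of "\<lambda>x. (\<alpha> x, \<alpha> (apply_bcontfun (conjugate h f) x))"] show ?thesis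
    by (simp add: image_rel_eq_image apply_conjugate[OF assms] inv_h)
qed

lemma partition_map_homeo:
  assumes "h \<in> Homeo" "partition_map I \<alpha>"
  shows "partition_map I (\<lambda>x. \<alpha> (apply_bcontfun h x))"
proof -
  have "range (apply_bcontfun h) = UNIV"
    using assms(1) Homeo_subset_Cs by (auto simp: Cs_def)
  then have "range (\<lambda>x. \<alpha> (apply_bcontfun h x)) = range \<alpha>"
    by (metis image_image)
  moreover have "locally_constant (\<lambda>x. \<alpha> (apply_bcontfun h x))"
    by (rule locally_constant_pre[OF _ continuous_on_apply_bcontfun])
      (use assms(2) in \<open>simp add: partition_map_iff\<close>)
  ultimately show ?thesis using assms(2) by (simp add: partition_map_iff)
qed

text \<open>
  Conjugating the map amounts to pulling back the partition by the homeomorphism.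
\<close>

lemma Gamma_conjugate:
  fixes f :: "'a::metric_space \<Rightarrow>\<^sub>C 'a"
  assumes "compact (UNIV :: 'a set)" "h \<in> Homeo"
  shows "Gamma (conjugate h f) \<subseteq> Gamma f"
proof
  fix \<phi> assume "\<phi> \<in> Gamma (conjugate h f)"
  then obtain I \<alpha> where "partition_map I \<alpha>" "\<phi> = image_rel (conjugate h f) \<alpha>" "\<phi> \<in> surj_rels"
    by (rule Gamma_image_rel)
  then show "\<phi> \<in> Gamma f"
    by (intro GammaI[OF partition_map_homeo[OF assms(2)]]) (simp_all add: image_rel_conjugate[OF assms])
qed

lemma conjugacy_invariant_Gamma_star:
  assumes "compact (UNIV :: 'a::metric_space set)"
  shows "conjugacy_invariant (Gamma_star Q :: ('a \<Rightarrow>\<^sub>C 'a) set)"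
  using conjugate_Cs[OF assms] Gamma_conjugate[OF assms]
  unfolding conjugacy_invariant_def Gamma_star_def by blast

section \<open>Condition Gamma for the relations of a set of maps\<close>

lemma Gamma_factor:
  assumes "\<phi> \<in> Gamma f" "factor_of \<psi> \<phi>" "\<psi> \<in> surj_rels"
  shows "\<psi> \<in> Gamma f"
proof -
  obtain I \<alpha> where \<alpha>: "partition_map I \<alpha>" "\<phi> = image_rel f \<alpha>"
    using assms(1) by (rule Gamma_image_rel)
  obtain I' J \<pi> where \<pi>: "surj_rel_on I' \<phi>" "surj_rel_on J \<psi>" "\<pi> ` I' = J" "map_prod \<pi> \<pi> ` \<phi> = \<psi>"
    using assms(2) by (auto simp: factor_of_def)
  have "J \<in> index_sets"
    using assms(3) \<pi>(2) by (auto simp: surj_rels_def surj_rel_on_def)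
  moreover have "I' = range \<alpha>"
    using surj_rel_on_domain[OF \<pi>(1)] fst_image_rel[of f \<alpha>] \<alpha>(2) by simp
  ultimately have "partition_map J (\<lambda>x. \<pi> (\<alpha> x))"
    using \<alpha>(1) \<pi>(3) by (auto simp: partition_map_iff locally_constant_post)
  then show ?thesis
    using \<pi>(4) \<alpha>(2) by (intro GammaI assms(3)) (auto simp: image_rel_post)
qed

text \<open>
  The label of \<open>x\<close> is refined to the list \<open>\<alpha> x @ \<alpha> (f x) @ [c]\<close>. The first block is the projection to the old label.
  The second block makes the old label of the image a function of the new label, as
  directionality requires. The last entry \<open>c\<close> cuts every cell of \<open>\<alpha>\<close> into two nonempty pieces, so that every
  fibre of the projection has at least two elements.
\<close>

lemma partition_plus_lift:
  fixes f :: "'a::metric_space \<Rightarrow>\<^sub>C 'a"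
  assumes cs: "cantor_space (UNIV :: 'a set)" and f: "f \<in> Cs" and \<alpha>: "partition_map I \<alpha>"
  obtains J \<beta> where "partition_map J \<beta>" "plus_lift (image_rel f \<beta>) (image_rel f \<alpha>)"
proof -
  have I: "I \<in> index_sets" and lc: "locally_constant \<alpha>" and rng: "range \<alpha> = I"
    using \<alpha> by (auto simp: partition_map_iff)
  obtain n where n: "n \<ge> 1" "\<And>xs. xs \<in> I \<Longrightarrow> length xs = n \<and> (\<forall>k\<in>set xs. k \<ge> 1)"
    using I by (auto simp: index_sets_def)
  have fin: "finite I" using I by (simp add: index_sets_def)
  \<comment> \<open>\<open>\<gamma> x\<close> pairs \<open>\<alpha> x\<close> with the half of its cell that contains \<open>x\<close>; cutting along \<open>{}\<close> leaves the choice of the halves free.\<close>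
  have "\<exists>\<gamma>. locally_constant \<gamma> \<and> range \<gamma> = I \<times> {1, 2::nat} \<and> (\<forall>x. fst (\<gamma> x) = \<alpha> x) \<and>
    (\<forall>x y. \<gamma> x = \<gamma> y \<longrightarrow> (x \<in> {} \<longleftrightarrow> y \<in> {}))"
  proof (rule refine_labelling[OF cs lc rng])
    show "fst ` (I \<times> {1, 2::nat}) = I" by force
    fix i assume "i \<in> I"
    then have "{j \<in> I \<times> {1, 2::nat}. fst j = i} = {(i, 1), (i, 2)}" by auto
    then show "card {j \<in> I \<times> {1, 2::nat}. fst j = i} > 1" by simp
  qed auto
  then obtain \<gamma> where \<gamma>: "locally_constant \<gamma>" "range \<gamma> = I \<times> {1, 2::nat}" "\<And>x. fst (\<gamma> x) = \<alpha> x"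
    by blast
  define \<beta> where "\<beta> = (\<lambda>x. \<alpha> x @ \<alpha> (apply_bcontfun f x) @ [snd (\<gamma> x)])"
  have in_I: "\<alpha> x \<in> I" for x using rng by auto
  have len: "length (\<alpha> x) = n" for x using n(2)[OF in_I] by simp
  have snd_\<gamma>: "snd (\<gamma> x) \<in> {1, 2}" for x
  proof -
    have "\<gamma> x \<in> I \<times> {1, 2}" using \<gamma>(2) by blast
    then show ?thesis by auto
  qed
  have take_\<beta>: "take n (\<beta> x) = \<alpha> x" for x by (simp add: \<beta>_def len)
  have next_\<beta>: "take n (drop n (\<beta> x)) = \<alpha> (apply_bcontfun f x)" for x by (simp add: \<beta>_def len)
  have "range \<beta> \<subseteq> (\<lambda>(a, b, c). a @ b @ [c]) ` (I \<times> I \<times> {1, 2})"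
  proof
    fix u assume "u \<in> range \<beta>"
    then obtain x where "u = \<beta> x" by blast
    then show "u \<in> (\<lambda>(a, b, c). a @ b @ [c]) ` (I \<times> I \<times> {1, 2})"
      using snd_\<gamma>[of x] in_I by (intro image_eqI[of _ _ "(\<alpha> x, \<alpha> (apply_bcontfun f x), snd (\<gamma> x))"])
        (simp_all add: \<beta>_def)
  qed
  then have fin_\<beta>: "finite (range \<beta>)" by (rule finite_subset) (simp add: fin)
  have "length (\<beta> x) = 2 * n + 1 \<and> (\<forall>k\<in>set (\<beta> x). k \<ge> 1)" for x
    using n(2)[OF in_I] snd_\<gamma>[of x] by (auto simp: \<beta>_def)
  then have J: "range \<beta> \<in> index_sets"
    using fin_\<beta> by (auto simp: index_sets_def intro!: exI[of _ "2 * n + 1"])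
  have lc_f: "locally_constant (\<lambda>x. \<alpha> (apply_bcontfun f x))"
    by (rule locally_constant_pre[OF lc continuous_on_apply_bcontfun])
  have "locally_constant \<beta>"
    using locally_constant_post[OF locally_constant_pair[OF lc locally_constant_pair[OF lc_f \<gamma>(1)]],
      of "\<lambda>(a, b, c). a @ b @ [snd c]"] by (simp add: \<beta>_def)
  then have part: "partition_map (range \<beta>) \<beta>" using J by (simp add: partition_map_iff)
  have card: "card {u \<in> range \<beta>. take n u = i} > 1" if "i \<in> I" for i
  proof -
    have "(i, 1) \<in> range \<gamma>" "(i, 2) \<in> range \<gamma>" using that \<gamma>(2) by auto
    then obtain x y where x: "\<gamma> x = (i, 1)" and y: "\<gamma> y = (i, 2)" by (metis imageE)
    have "\<alpha> x = i" "\<alpha> y = i" using \<gamma>(3) x y by (metis fst_conv)+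
    then have sub: "{\<beta> x, \<beta> y} \<subseteq> {u \<in> range \<beta>. take n u = i}" by (simp add: take_\<beta>)
    have "last (\<beta> x) \<noteq> last (\<beta> y)" by (simp add: \<beta>_def x y)
    then have "\<beta> x \<noteq> \<beta> y" by metis
    then have "card {\<beta> x, \<beta> y} = 2" by simp
    moreover have fin: "finite {u \<in> range \<beta>. take n u = i}"
      using fin_\<beta> by (rule rev_finite_subset) blast
    ultimately have "2 \<le> card {u \<in> range \<beta>. take n u = i}"
      using card_mono[OF fin sub] by simp
    then show ?thesis by simp
  qed
  have "plus_lift (image_rel f \<beta>) (image_rel f \<alpha>)"
    unfolding plus_lift_def
  proof (rule bexI[OF _ J], rule bexI[OF _ I], rule exI[of _ "take n"], intro conjI)
    show "surj_rel_on (range \<beta>) (image_rel f \<beta>)" by (rule surj_rel_on_image_rel[OF f part])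
    show "surj_rel_on I (image_rel f \<alpha>)" by (rule surj_rel_on_image_rel[OF f \<alpha>])
    show "\<forall>i\<in>I. card {u \<in> range \<beta>. take n u = i} > 1" using card by blast
    show "take n ` range \<beta> = I" by (simp add: image_image take_\<beta> rng)
    show "map_prod (take n) (take n) ` image_rel f \<beta> = image_rel f \<alpha>"
      by (simp add: image_rel_post take_\<beta>)
    show "\<exists>g. g ` range \<beta> \<subseteq> I \<and>
      {(a, take n b) |a b. (a, b) \<in> image_rel f \<beta>} = {(a, g a) |a. a \<in> range \<beta>}"
    proof (intro exI[of _ "\<lambda>u. take n (drop n u)"] conjI)
      show "(\<lambda>u. take n (drop n u)) ` range \<beta> \<subseteq> I" using in_I by (auto simp: next_\<beta>)
      have "{(a, take n b) |a b. (a, b) \<in> image_rel f \<beta>} =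
          {(\<beta> x, take n (\<beta> (apply_bcontfun f x))) |x. True}"
        unfolding image_rel_def by blast
      also have "\<dots> = {(\<beta> x, take n (drop n (\<beta> x))) |x. True}"
        by (simp only: take_\<beta> next_\<beta>)
      also have "\<dots> = {(a, take n (drop n a)) |a. a \<in> range \<beta>}" by blast
      finally show "{(a, take n b) |a b. (a, b) \<in> image_rel f \<beta>} =
        {(a, take n (drop n a)) |a. a \<in> range \<beta>}" .
    qed
  qed
  then show thesis using part that by blast
qed

lemma condition_Gamma_Gamma_set:
  fixes K :: "('a::metric_space \<Rightarrow>\<^sub>C 'a) set"
  assumes cs: "cantor_space (UNIV :: 'a set)" and K: "K \<noteq> {}" "K \<subseteq> Cs"
  shows "condition_Gamma (Gamma_set K)"
  unfolding condition_Gamma_def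
proof (intro conjI ballI impI)
  obtain f where "f \<in> K" using K by blast
  moreover obtain I and \<alpha> :: "'a \<Rightarrow> index" where "partition_map I \<alpha>"
    by (rule fine_partition_map[OF cs zero_less_one])
  ultimately have "image_rel f \<alpha> \<in> Gamma_set K"
    using image_rel_in_Gamma[of f I \<alpha>] K(2) by (auto simp: Gamma_set_def)
  then show "Gamma_set K \<noteq> {}" by blast
  show "Gamma_set K \<subseteq> surj_rels" by (auto simp: Gamma_set_def Gamma_def)
  fix \<phi> assume "\<phi> \<in> Gamma_set K"
  then obtain f where f: "f \<in> K" "\<phi> \<in> Gamma f" by (auto simp: Gamma_set_def)
  {
    fix \<psi> assume "\<psi> \<in> surj_rels" "factor_of \<psi> \<phi>"
    then show "\<psi> \<in> Gamma_set K"
      using f Gamma_factor by (auto simp: Gamma_set_def)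
  }
  obtain I \<alpha> where \<alpha>: "partition_map I \<alpha>" "\<phi> = image_rel f \<alpha>"
    using f(2) by (rule Gamma_image_rel)
  have "f \<in> Cs" using f K by blast
  then obtain J \<beta> where \<beta>: "partition_map J \<beta>" "plus_lift (image_rel f \<beta>) (image_rel f \<alpha>)"
    using partition_plus_lift[OF cs _ \<alpha>(1)] by blast
  then have "image_rel f \<beta> \<in> Gamma_set K"
    using f(1) image_rel_in_Gamma[OF \<open>f \<in> Cs\<close>] by (auto simp: Gamma_set_def)
  then show "\<exists>\<psi>\<in>Gamma_set K. plus_lift \<psi> \<phi>" using \<beta>(2) \<alpha>(2) by blast
qed

section \<open>Equal relations imply density\<close>

text \<open>
  Take a fine partition \<open>\<alpha>\<close> and the relation of \<open>f\<close> on it. Some \<open>g \<in> K0\<close> induces the same relation on another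
  partition \<open>\<beta>\<close> with the same labels, and a homeomorphism carrying \<open>\<beta>\<close> to \<open>\<alpha>\<close> conjugates \<open>g\<close> to a map that induces the
  relation of \<open>f\<close> on \<open>\<alpha>\<close> itself. Two maps with the same relation on a sufficiently fine partition are
  uniformly close.
\<close>

lemma Gamma_set_eq_imp_dense:
  fixes K0 K :: "('a::metric_space \<Rightarrow>\<^sub>C 'a) set"
  assumes cs: "cantor_space (UNIV :: 'a set)" and "K \<subseteq> Cs"
    and inv: "conjugacy_invariant K0" and sub: "Gamma_set K \<subseteq> Gamma_set K0"
  shows "K \<subseteq> closure K0"
proof
  fix f assume "f \<in> K"
  have cpt: "compact (UNIV :: 'a set)" by (rule cantor_compact[OF cs])
  show "f \<in> closure K0"
    unfolding closure_approachable
  proof (intro allI impI)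
    fix e :: real assume "e > 0"
    have "uniformly_continuous_on UNIV (apply_bcontfun f)"
      by (intro compact_uniformly_continuous cpt continuous_on_apply_bcontfun)
    then obtain d where d: "d > 0"
      "\<And>x y. dist x y < d \<Longrightarrow> dist (apply_bcontfun f x) (apply_bcontfun f y) < e / 3"
      using \<open>e > 0\<close> unfolding uniformly_continuous_on_def
      by (metis UNIV_I zero_less_divide_iff zero_less_numeral)
    have "min d (e / 3) > 0" using d \<open>e > 0\<close> by simp
    then obtain I and \<alpha> :: "'a \<Rightarrow> index" where \<alpha>: "partition_map I \<alpha>"
      "\<And>x y. \<alpha> x = \<alpha> y \<Longrightarrow> dist x y < min d (e / 3)"
      using fine_partition_map[OF cs] by blast
    have "image_rel f \<alpha> \<in> Gamma_set K"
      using image_rel_in_Gamma[OF _ \<alpha>(1)] \<open>f \<in> K\<close> \<open>K \<subseteq> Cs\<close> by (auto simp: Gamma_set_def)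
    then obtain g where g: "g \<in> K0" "image_rel f \<alpha> \<in> Gamma g"
      using sub by (auto simp: Gamma_set_def)
    obtain J \<beta> where \<beta>: "partition_map J \<beta>" "image_rel f \<alpha> = image_rel g \<beta>"
      using g(2) by (rule Gamma_image_rel)
    have "range \<alpha> = range \<beta>" using \<beta>(2) fst_image_rel by metis
    moreover have "locally_constant \<alpha>" "locally_constant \<beta>"
      using \<alpha>(1) \<beta>(1) by (simp_all add: partition_map_iff)
    ultimately obtain h h' where h: "homeomorphism UNIV UNIV h h'" "\<And>x. \<alpha> (h x) = \<beta> x"
      using partition_homeomorphism[OF cs] by blast
    define H where "H = Bcontfun h"
    have apply_H: "apply_bcontfun H = h"
      unfolding H_def using h(1) by (intro Bcontfun_inverse_compact cpt) (simp add: homeomorphism_def)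
    have H: "H \<in> Homeo" using h(1) by (auto simp: Homeo_def apply_H)
    let ?g = "conjugate H g"
    have same: "image_rel ?g \<alpha> = image_rel f \<alpha>"
      by (simp add: image_rel_conjugate[OF cpt H] apply_H h(2) \<beta>(2))
    have "dist (apply_bcontfun ?g x) (apply_bcontfun f x) \<le> 2 * e / 3" for x
    proof -
      have "(\<alpha> x, \<alpha> (apply_bcontfun ?g x)) \<in> image_rel f \<alpha>"
        unfolding same[symmetric] by (auto simp: image_rel_def)
      then obtain y where "\<alpha> x = \<alpha> y" "\<alpha> (apply_bcontfun ?g x) = \<alpha> (apply_bcontfun f y)"
        by (auto simp: image_rel_def)
      \<comment> \<open>\<open>x\<close> and \<open>y\<close> share a cell of diameter at most \<open>d\<close>, and the two images share a cell of diameter at most \<open>e / 3\<close>.\<close>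
      then have "dist (apply_bcontfun f y) (apply_bcontfun f x) < e / 3"
        "dist (apply_bcontfun ?g x) (apply_bcontfun f y) < e / 3"
        using \<alpha>(2)[of y x] \<alpha>(2)[of "apply_bcontfun ?g x" "apply_bcontfun f y"] d(2) by auto
      then show ?thesis
        using dist_triangle[of "apply_bcontfun ?g x" "apply_bcontfun f x" "apply_bcontfun f y"] by simp
    qed
    then have "dist ?g f \<le> 2 * e / 3" by (rule dist_bound)
    then have "dist ?g f < e" using \<open>e > 0\<close> by simp
    moreover have "?g \<in> K0" using inv g(1) H by (auto simp: conjugacy_invariant_def)
    ultimately show "\<exists>g\<in>K0. dist g f < e" by blast
  qed
qed

section \<open>Realizing a tower of lifts by a homeomorphism\<close>

text \<open>
  A lift in which both the image and the preimage of a label have a well-defined projection: \<open>F\<close> and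
  \<open>B\<close> are the approximations, one level down, of a map and of its inverse.
\<close>

definition two_sided_lift ::
    "'i rel \<Rightarrow> 'i rel \<Rightarrow> ('i \<Rightarrow> 'i) \<Rightarrow> ('i \<Rightarrow> 'i) \<Rightarrow> ('i \<Rightarrow> 'i) \<Rightarrow> bool" where
  "two_sided_lift \<psi> \<phi> \<rho> F B \<longleftrightarrow>
     map_prod \<rho> \<rho> ` \<psi> = \<phi> \<and> (\<forall>(a, b)\<in>\<psi>. \<rho> b = F a \<and> \<rho> a = B b) \<and>
     (\<forall>i\<in>fst ` \<phi>. card {a \<in> fst ` \<psi>. \<rho> a = i} > 1)"

text \<open>
  A lift \<open>\<psi>\<close> of \<open>\<phi>\<close> has a second projection onto \<open>\<phi>\<close>. Along an edge \<open>(a, b)\<close> of \<open>\<psi>\<close> directionality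
  says \<open>\<pi> b = g a\<close>. Hence \<open>g\<close> maps an edge \<open>(a, b)\<close> with successor edge \<open>(b, c)\<close> to \<open>(\<pi> b, \<pi> c)\<close>, which is
  an edge of \<open>\<phi>\<close>, and every edge of \<open>\<phi>\<close> arises this way since every label has a predecessor. As a
  projection, \<open>g\<close> is directional for the reversed relation: the \<open>g\<close>-image of \<open>a\<close> is determined by
  the successor \<open>b\<close>.
\<close>

lemma plus_lift_shifted_projection:
  assumes "plus_lift \<psi> \<phi>"
  obtains \<pi> g where "map_prod \<pi> \<pi> ` \<psi> = \<phi>" "map_prod g g ` \<psi> = \<phi>"
    "\<And>a b. (a, b) \<in> \<psi> \<Longrightarrow> \<pi> b = g a"
    "\<And>i. i \<in> fst ` \<phi> \<Longrightarrow> card {a \<in> fst ` \<psi>. \<pi> a = i} > 1" "finite (fst ` \<psi>)"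
proof -
  obtain I1 I \<pi> g where I1: "I1 \<in> index_sets" and rel: "surj_rel_on I1 \<psi>" "surj_rel_on I \<phi>"
    and \<pi>: "map_prod \<pi> \<pi> ` \<psi> = \<phi>"
    and g: "{(a, \<pi> b) | a b. (a, b) \<in> \<psi>} = {(a, g a) | a. a \<in> I1}"
    and card: "\<forall>i\<in>I. card {a \<in> I1. \<pi> a = i} > 1"
    using assms unfolding plus_lift_def by (elim bexE exE conjE) (rule that; assumption)
  have dom: "fst ` \<psi> = I1" "snd ` \<psi> = I1" "fst ` \<phi> = I"
    using rel by (auto simp: surj_rel_on_def)
  have \<pi>g: "\<pi> b = g a" if "(a, b) \<in> \<psi>" for a b
  proof -
    have "(a, \<pi> b) \<in> {(a, \<pi> b) | a b. (a, b) \<in> \<psi>}" using that by blast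
    then show ?thesis unfolding g by blast
  qed
  have "map_prod g g ` \<psi> = \<phi>"
  proof (intro equalityI subsetI)
    fix p assume "p \<in> map_prod g g ` \<psi>"
    then obtain a b where ab: "(a, b) \<in> \<psi>" "p = (g a, g b)" by auto
    have "b \<in> fst ` \<psi>" using dom ab(1) by (metis image_eqI snd_conv)
    then obtain c where "(b, c) \<in> \<psi>" by auto
    then have "p = map_prod \<pi> \<pi> (b, c)" using \<pi>g ab by simp
    then show "p \<in> \<phi>" using \<pi> \<open>(b, c) \<in> \<psi>\<close> by blast
  next
    fix p assume "p \<in> \<phi>"
    then obtain b c where bc: "(b, c) \<in> \<psi>" "p = (\<pi> b, \<pi> c)" using \<pi> by auto
    have "b \<in> snd ` \<psi>" using dom bc(1) by (metis image_eqI fst_conv)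
    then obtain a where "(a, b) \<in> \<psi>" by auto
    then have "p = map_prod g g (a, b)" using \<pi>g bc by simp
    then show "p \<in> map_prod g g ` \<psi>" using \<open>(a, b) \<in> \<psi>\<close> by blast
  qed
  moreover have "finite (fst ` \<psi>)" using dom I1 by (simp add: index_sets_def)
  moreover have "card {a \<in> fst ` \<psi>. \<pi> a = i} > 1" if "i \<in> fst ` \<phi>" for i
    using card that dom by simp
  ultimately show thesis using that \<pi> \<pi>g by blast
qed

text \<open>
  Project the upper lift by its own projection \<open>\<pi>1\<close> and the lower one by its shifted projection \<open>g0\<close>. Along
  an edge \<open>(a, b)\<close> of \<open>\<phi>2\<close> the composite satisfies \<open>g0 (\<pi>1 b) = g0 (g1 a)\<close> because the upper lift is directional, and
  \<open>g0 (\<pi>1 a) = \<pi>0 (\<pi>1 b)\<close> because \<open>(\<pi>1 a, \<pi>1 b)\<close> is an edge of \<open>\<phi>1\<close>. So two successive lifts to the same side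
  combine to a lift to both sides, which is the reason why the realizing map can be
  made invertible.
\<close>

lemma plus_lifts_two_sided:
  assumes "plus_lift \<phi>1 \<phi>0" "plus_lift \<phi>2 \<phi>1"
  shows "\<exists>\<rho> F B. two_sided_lift \<phi>2 \<phi>0 \<rho> F B"
proof -
  obtain \<pi>0 g0 where l0: "map_prod g0 g0 ` \<phi>1 = \<phi>0" "\<And>a b. (a, b) \<in> \<phi>1 \<Longrightarrow> \<pi>0 b = g0 a"
    by (rule plus_lift_shifted_projection[OF assms(1)]) (rule that; assumption)
  obtain \<pi>1 g1 where l1: "map_prod \<pi>1 \<pi>1 ` \<phi>2 = \<phi>1" "\<And>a b. (a, b) \<in> \<phi>2 \<Longrightarrow> \<pi>1 b = g1 a"
    "\<And>i. i \<in> fst ` \<phi>1 \<Longrightarrow> card {a \<in> fst ` \<phi>2. \<pi>1 a = i} > 1" "finite (fst ` \<phi>2)"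
    by (rule plus_lift_shifted_projection[OF assms(2)]) (rule that; assumption)
  have "two_sided_lift \<phi>2 \<phi>0 (g0 \<circ> \<pi>1) (g0 \<circ> g1) (\<pi>0 \<circ> \<pi>1)"
    unfolding two_sided_lift_def
  proof (intro conjI ballI)
    show "map_prod (g0 \<circ> \<pi>1) (g0 \<circ> \<pi>1) ` \<phi>2 = \<phi>0"
      using l0(1) l1(1) by (metis image_comp map_prod.comp)
    fix p assume p: "p \<in> \<phi>2"
    obtain a b where ab: "p = (a, b)" by fastforce
    have "map_prod \<pi>1 \<pi>1 (a, b) \<in> \<phi>1" using l1(1) p ab by blast
    then have "\<pi>0 (\<pi>1 b) = g0 (\<pi>1 a)" by (intro l0(2)) simp
    then show "case p of (a, b) \<Rightarrow>
        (g0 \<circ> \<pi>1) b = (g0 \<circ> g1) a \<and> (g0 \<circ> \<pi>1) a = (\<pi>0 \<circ> \<pi>1) b"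
      using l1(2) p ab by simp
  next
    fix i assume "i \<in> fst ` \<phi>0"
    then obtain c where c: "c \<in> fst ` \<phi>1" "g0 c = i" using l0(1) by force
    have "card {a \<in> fst ` \<phi>2. \<pi>1 a = c} \<le> card {a \<in> fst ` \<phi>2. (g0 \<circ> \<pi>1) a = i}"
      using l1(4) c(2) by (intro card_mono) auto
    then show "card {a \<in> fst ` \<phi>2. (g0 \<circ> \<pi>1) a = i} > 1" using l1(3)[OF c(1)] by simp
  qed
  then show ?thesis by blast
qed

lemma two_sided_lift_D:
  assumes "two_sided_lift \<psi> \<phi> \<rho> F B" "(a, b) \<in> \<psi>"
  shows "(\<rho> a, \<rho> b) \<in> \<phi>" "F a = \<rho> b" "B b = \<rho> a"
  using assms unfolding two_sided_lift_def by force+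

text \<open>
  Code the space by the labels of the tower. The point with thread \<open>\<alpha> k x\<close> goes to the point with
  thread \<open>F k (\<alpha> (Suc k) x)\<close>; that this is a thread, that \<open>B\<close> gives the inverse, and that the relation on
  level \<open>k\<close> is \<open>\<phi> k\<close> are all checked by choosing an edge of a higher relation over the label in question.
\<close>

lemma two_sided_tower_realization:
  fixes \<phi> :: "nat \<Rightarrow> 'i rel"
  assumes cs: "cantor_space (UNIV :: 'a::metric_space set)"
    and lift: "\<And>k. two_sided_lift (\<phi> (Suc k)) (\<phi> k) (\<rho> k) (F k) (B k)"
    and dom: "\<And>k. snd ` \<phi> k = fst ` \<phi> k"
    and ne: "\<phi> 0 \<noteq> {}" "finite (\<phi> 0)"
  obtains f f' and \<alpha> :: "nat \<Rightarrow> 'a::metric_space \<Rightarrow> 'i" where "cantor_coding (\<lambda>k. fst ` \<phi> k) \<rho> \<alpha>"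
    "homeomorphism UNIV UNIV f f'" "\<And>k. range (\<lambda>x. (\<alpha> k x, \<alpha> k (f x))) = \<phi> k"
proof -
  define I where "I = (\<lambda>k. fst ` \<phi> k)"
  note D = two_sided_lift_D[OF lift]
  have img: "\<phi> k = map_prod (\<rho> k) (\<rho> k) ` \<phi> (Suc k)" for k
    using lift[of k] by (simp add: two_sided_lift_def)
  have out: "\<exists>b. (a, b) \<in> \<phi> k" if "a \<in> I k" for a k using that by (auto simp: I_def)
  have into: "\<exists>a. (a, b) \<in> \<phi> k" if "b \<in> I k" for b k
    using that dom[of k] unfolding I_def by (metis imageE prod.collapse)
  have memI: "a \<in> I k" "b \<in> I k" if "(a, b) \<in> \<phi> k" for a b k
    using that dom[of k] unfolding I_def by (metis image_eqI fst_conv, metis image_eqI snd_conv)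
  interpret splitting_system I \<rho>
  proof
    show "\<rho> k ` I (Suc k) = I k" for k
      unfolding I_def by (subst img[of k]) (simp add: image_image)
    show "card {j \<in> I (Suc k). \<rho> k j = i} > 1" if "i \<in> I k" for i k
      using lift[of k] that unfolding two_sided_lift_def I_def by blast
  qed
  have "finite (I 0)" "I 0 \<noteq> {}" using ne by (simp_all add: I_def)
  then obtain \<alpha>0 :: "'a \<Rightarrow> 'i" where \<alpha>0: "locally_constant \<alpha>0" "range \<alpha>0 = I 0"
    using clopen_split[OF cs _ _ open_UNIV closed_UNIV UNIV_not_empty] by blast
  obtain \<alpha> :: "nat \<Rightarrow> 'a \<Rightarrow> 'i" where coding: "cantor_coding I \<rho> \<alpha>"
    using coding_exists[OF cs \<alpha>0] by blast
  interpret cantor_coding I \<rho> \<alpha> by fact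
  have in_I: "\<alpha> k x \<in> I k" for k x using range[of k] by blast
  have "\<exists>y. \<forall>k. \<alpha> k y = F k (\<alpha> (Suc k) x)" for x
  proof (rule thread_point)
    fix k
    obtain b where b: "(\<alpha> (Suc k) x, b) \<in> \<phi> (Suc k)" using out in_I by blast
    show "F k (\<alpha> (Suc k) x) \<in> I k" unfolding D(2)[OF b] using memI(2) D(1)[OF b] by blast
    obtain c where c: "(\<alpha> (Suc (Suc k)) x, c) \<in> \<phi> (Suc (Suc k))" using out in_I by blast
    have "(\<alpha> (Suc k) x, \<rho> (Suc k) c) \<in> \<phi> (Suc k)" using D(1)[OF c] by (simp add: compat)
    then show "\<rho> k (F (Suc k) (\<alpha> (Suc (Suc k)) x)) = F k (\<alpha> (Suc k) x)"
      using D(2) D(2)[OF c] by simp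
  qed blast
  then obtain f where f: "\<And>k x. \<alpha> k (f x) = F k (\<alpha> (Suc k) x)" by metis
  have "\<exists>y. \<forall>k. \<alpha> k y = B k (\<alpha> (Suc k) x)" for x
  proof (rule thread_point)
    fix k
    obtain a where a: "(a, \<alpha> (Suc k) x) \<in> \<phi> (Suc k)" using into in_I by blast
    show "B k (\<alpha> (Suc k) x) \<in> I k" unfolding D(3)[OF a] using memI(1) D(1)[OF a] by blast
    obtain c where c: "(c, \<alpha> (Suc (Suc k)) x) \<in> \<phi> (Suc (Suc k))" using into in_I by blast
    have "(\<rho> (Suc k) c, \<alpha> (Suc k) x) \<in> \<phi> (Suc k)" using D(1)[OF c] by (simp add: compat)
    then show "\<rho> k (B (Suc k) (\<alpha> (Suc (Suc k)) x)) = B k (\<alpha> (Suc k) x)"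
      using D(3) D(3)[OF c] by simp
  qed blast
  then obtain f' where f': "\<And>k x. \<alpha> k (f' x) = B k (\<alpha> (Suc k) x)" by metis
  have "homeomorphism UNIV UNIV f f'"
  proof (rule homeomorphismI)
    show "continuous_on UNIV f"
      by (rule continuous_if_coded) (simp add: f locally_constant_post lc)
    show "continuous_on UNIV f'"
      by (rule continuous_if_coded) (simp add: f' locally_constant_post lc)
    show "f (f' x) = x" for x
    proof (rule separating)
      fix k
      obtain a where a: "(a, \<alpha> (Suc (Suc k)) x) \<in> \<phi> (Suc (Suc k))" using into in_I by blast
      have "(\<rho> (Suc k) a, \<alpha> (Suc k) x) \<in> \<phi> (Suc k)" using D(1)[OF a] by (simp add: compat)
      then have "F k (\<rho> (Suc k) a) = \<alpha> k x" using D(2) compat by simp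
      then show "\<alpha> k (f (f' x)) = \<alpha> k x" by (simp add: f f' D(3)[OF a])
    qed
    show "f' (f x) = x" for x
    proof (rule separating)
      fix k
      obtain b where b: "(\<alpha> (Suc (Suc k)) x, b) \<in> \<phi> (Suc (Suc k))" using out in_I by blast
      have "(\<alpha> (Suc k) x, \<rho> (Suc k) b) \<in> \<phi> (Suc k)" using D(1)[OF b] by (simp add: compat)
      then have "B k (\<rho> (Suc k) b) = \<alpha> k x" using D(3) compat by simp
      then show "\<alpha> k (f' (f x)) = \<alpha> k x" by (simp add: f f' D(2)[OF b])
    qed
  qed auto
  moreover have "range (\<lambda>x. (\<alpha> k x, \<alpha> k (f x))) = \<phi> k" for k
  proof (intro equalityI subsetI)
    fix p assume "p \<in> range (\<lambda>x. (\<alpha> k x, \<alpha> k (f x)))"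
    then obtain x where x: "p = (\<alpha> k x, \<alpha> k (f x))" by blast
    obtain b where b: "(\<alpha> (Suc k) x, b) \<in> \<phi> (Suc k)" using out in_I by blast
    then show "p \<in> \<phi> k" using D(1)[OF b] D(2)[OF b] by (simp add: x f compat)
  next
    fix p assume "p \<in> \<phi> k"
    then obtain a b where ab: "(a, b) \<in> \<phi> (Suc k)" "p = (\<rho> k a, \<rho> k b)"
      by (subst (asm) img[of k]) auto
    then have "a \<in> range (\<alpha> (Suc k))" using memI(1) range by blast
    then obtain x where x: "\<alpha> (Suc k) x = a" by blast
    have "p = (\<alpha> k x, \<alpha> k (f x))"
      using compat[of k x] f[of k x] D(2)[OF ab(1)] by (simp add: x ab(2))
    then show "p \<in> range (\<lambda>x. (\<alpha> k x, \<alpha> k (f x)))" by blast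
  qed
  ultimately show thesis by (rule that[OF coding[unfolded I_def]])
qed

text \<open>
  Iterated lifting inside \<open>Q\<close> gives a tower, and the homeomorphism realizing it has \<open>\<phi>\<close> among its relations. It has
  no relations outside \<open>Q\<close>: every partition factors through a level of the coding, so its relation is a
  factor of a member of the tower.
\<close>

lemma condition_Gamma_realization:
  assumes cs: "cantor_space (UNIV :: 'a::metric_space set)"
    and Q: "condition_Gamma Q" and "\<phi> \<in> Q"
  shows "\<phi> \<in> Gamma_set (Homeo \<inter> Gamma_star Q :: ('a \<Rightarrow>\<^sub>C 'a) set)"
proof -
  have sub: "Q \<subseteq> surj_rels"
    and factors: "\<And>\<phi> \<psi>. \<lbrakk>\<phi> \<in> Q; \<psi> \<in> surj_rels; factor_of \<psi> \<phi>\<rbrakk> \<Longrightarrow> \<psi> \<in> Q"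
    and lifts: "\<And>\<phi>. \<phi> \<in> Q \<Longrightarrow> \<exists>\<psi>\<in>Q. plus_lift \<psi> \<phi>"
    using Q unfolding condition_Gamma_def by blast+
  have "\<exists>\<Phi>. \<forall>k. (\<Phi> k \<in> Q \<and> (k = 0 \<longrightarrow> \<Phi> k = \<phi>)) \<and>
    (\<exists>\<rho> F B. two_sided_lift (\<Phi> (Suc k)) (\<Phi> k) \<rho> F B)"
  proof (rule dependent_nat_choice)
    show "\<exists>\<psi>. \<psi> \<in> Q \<and> (0 = 0 \<longrightarrow> \<psi> = \<phi>)" using \<open>\<phi> \<in> Q\<close> by blast
    fix \<psi> and k :: nat
    assume "\<psi> \<in> Q \<and> (k = 0 \<longrightarrow> \<psi> = \<phi>)"
    then obtain \<psi>1 \<psi>2 where "\<psi>1 \<in> Q" "plus_lift \<psi>1 \<psi>" "\<psi>2 \<in> Q" "plus_lift \<psi>2 \<psi>1"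
      using lifts by metis
    then show "\<exists>\<psi>2. (\<psi>2 \<in> Q \<and> (Suc k = 0 \<longrightarrow> \<psi>2 = \<phi>)) \<and>
      (\<exists>\<rho> F B. two_sided_lift \<psi>2 \<psi> \<rho> F B)"
      using plus_lifts_two_sided[of \<psi>1 \<psi> \<psi>2] by (intro exI[of _ \<psi>2]) simp
  qed
  then obtain \<Phi> where \<Phi>_all: "\<forall>k. (\<Phi> k \<in> Q \<and> (k = 0 \<longrightarrow> \<Phi> k = \<phi>)) \<and>
    (\<exists>\<rho> F B. two_sided_lift (\<Phi> (Suc k)) (\<Phi> k) \<rho> F B)" ..
  then have \<Phi>: "\<And>k. \<Phi> k \<in> Q" "\<Phi> 0 = \<phi>"
    "\<And>k. \<exists>\<rho> F B. two_sided_lift (\<Phi> (Suc k)) (\<Phi> k) \<rho> F B" by simp_all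
  obtain \<rho> F B where lift: "\<And>k. two_sided_lift (\<Phi> (Suc k)) (\<Phi> k) (\<rho> k) (F k) (B k)"
    using \<Phi>(3) by metis
  have \<Phi>_rel: "surj_rel_on (fst ` \<Phi> k) (\<Phi> k)" "fst ` \<Phi> k \<in> index_sets" for k
  proof -
    obtain I where "I \<in> index_sets" "surj_rel_on I (\<Phi> k)"
      using \<Phi>(1) sub by (auto simp: surj_rels_def)
    then show "surj_rel_on (fst ` \<Phi> k) (\<Phi> k)" "fst ` \<Phi> k \<in> index_sets"
      by (simp_all add: surj_rel_on_domain)
  qed
  have "\<Phi> 0 \<subseteq> fst ` \<Phi> 0 \<times> fst ` \<Phi> 0" using \<Phi>_rel(1) by (simp add: surj_rel_on_def)
  then have fin: "finite (\<Phi> 0)"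
    using \<Phi>_rel(2)[of 0] by (intro finite_subset[of "\<Phi> 0"]) (auto simp: index_sets_def)
  have ne: "\<Phi> 0 \<noteq> {}" using \<Phi>_rel(2)[of 0] by (auto simp: index_sets_def)
  obtain f f' and \<alpha> :: "nat \<Rightarrow> 'a \<Rightarrow> index" where
    coding: "cantor_coding (\<lambda>k. fst ` \<Phi> k) \<rho> \<alpha>" and f: "homeomorphism UNIV UNIV f f'"
    and img: "\<And>k. range (\<lambda>x. (\<alpha> k x, \<alpha> k (f x))) = \<Phi> k"
    by (rule two_sided_tower_realization[OF cs lift surj_rel_on_range[OF \<Phi>_rel(1)] ne fin])
      (rule that; assumption)
  interpret cantor_coding "\<lambda>k. fst ` \<Phi> k" \<rho> \<alpha> by fact
  define h where "h = Bcontfun f"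
  have apply_h: "apply_bcontfun h = f"
    unfolding h_def using f
    by (intro Bcontfun_inverse_compact cantor_compact[OF cs]) (simp add: homeomorphism_def)
  have Homeo: "h \<in> Homeo" using f by (auto simp: Homeo_def apply_h)
  have img_h: "image_rel h (\<alpha> k) = \<Phi> k" for k
    by (simp add: image_rel_eq_image apply_h img)
  have part: "partition_map (fst ` \<Phi> k) (\<alpha> k)" for k
    using \<Phi>_rel(2) lc range by (simp add: partition_map_iff)
  have "Gamma h \<subseteq> Q"
  proof
    fix \<psi> assume \<psi>: "\<psi> \<in> Gamma h"
    then obtain J \<beta> where \<beta>: "partition_map J \<beta>" "\<psi> = image_rel h \<beta>" "\<psi> \<in> surj_rels"
      by (rule Gamma_image_rel)
    have "locally_constant \<beta>" using \<beta>(1) by (simp add: partition_map_iff)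
    then obtain k where k: "\<And>x y. \<alpha> k x = \<alpha> k y \<Longrightarrow> \<beta> x = \<beta> y"
      by (rule factors_through) blast
    define \<pi> where "\<pi> = (\<lambda>i. \<beta> (inv (\<alpha> k) i))"
    have \<pi>: "\<pi> (\<alpha> k x) = \<beta> x" for x
      unfolding \<pi>_def by (rule k) (simp add: f_inv_into_f)
    have "\<pi> ` fst ` \<Phi> k = range \<beta>" by (simp add: range[symmetric] image_image \<pi>)
    moreover have "map_prod \<pi> \<pi> ` \<Phi> k = \<psi>"
      by (simp add: img_h[symmetric] image_rel_post \<pi> \<beta>(2))
    moreover have "surj_rel_on (range \<beta>) \<psi>"
      using surj_rel_on_image_rel[OF _ \<beta>(1)] \<beta>(1,2) Homeo Homeo_subset_Cs
      by (auto simp: partition_map_iff)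
    ultimately have "factor_of \<psi> (\<Phi> k)" using \<Phi>_rel(1) unfolding factor_of_def by blast
    then show "\<psi> \<in> Q" using factors \<Phi>(1) \<beta>(3) by blast
  qed
  then have "h \<in> Homeo \<inter> Gamma_star Q"
    using Homeo Homeo_subset_Cs by (auto simp: Gamma_star_def)
  moreover have "\<phi> \<in> Gamma h"
    using image_rel_in_Gamma[OF _ part[of 0]] img_h[of 0] \<Phi>(2) Homeo Homeo_subset_Cs by auto
  ultimately show ?thesis by (auto simp: Gamma_set_def)
qed

section \<open>Relations and closed conjugacy invariant sets\<close>

theorem theorem3p12:
  fixes K0 K :: "('a::metric_space \<Rightarrow>\<^sub>C 'a) set" and Q :: "index rel set"
  assumes "cantor_space (UNIV :: 'a set)"
    and "K0 \<noteq> {}" and "K \<noteq> {}" and "K0 \<subseteq> K" and "K \<subseteq> Cs"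
    and "Q \<subseteq> surj_rels"
  shows
    "(Gamma_set (Gamma_star Q :: ('a \<Rightarrow>\<^sub>C 'a) set) \<subseteq> Q \<and>
      K \<subseteq> Gamma_star (Gamma_set K) \<and>
      Gamma_star (Gamma_set (Gamma_star Q :: ('a \<Rightarrow>\<^sub>C 'a) set)) = (Gamma_star Q :: ('a \<Rightarrow>\<^sub>C 'a) set) \<and>
      Gamma_set K = Gamma_set (Gamma_star (Gamma_set K) :: ('a \<Rightarrow>\<^sub>C 'a) set)) \<and>
     (closedin (top_of_set Cs) (Gamma_star Q :: ('a \<Rightarrow>\<^sub>C 'a) set) \<and>
     conjugacy_invariant (Gamma_star Q :: ('a \<Rightarrow>\<^sub>C 'a) set)) \<and>
     (condition_Gamma (Gamma_set K)) \<and>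
     (K \<subseteq> closure K0 \<longrightarrow> Gamma_set K0 = Gamma_set K) \<and>
     (conjugacy_invariant K0 \<and> conjugacy_invariant K \<and> Gamma_set K0 = Gamma_set K \<longrightarrow>
     K \<subseteq> closure K0) \<and>
     ((closedin (top_of_set Cs) K \<and> conjugacy_invariant K \<longrightarrow> K = Gamma_star (Gamma_set K)) \<and>
     (K \<subseteq> Homeo \<and> closedin (top_of_set Homeo) K \<and> conjugacy_invariant K \<longrightarrow>
      K = Homeo \<inter> Gamma_star (Gamma_set K))) \<and>
     (condition_Gamma Q \<longrightarrow>
     Q = Gamma_set (Gamma_star Q :: ('a \<Rightarrow>\<^sub>C 'a) set) \<and>
     Gamma_set (Gamma_star Q :: ('a \<Rightarrow>\<^sub>C 'a) set) =
       Gamma_set (Homeo \<inter> Gamma_star Q :: ('a \<Rightarrow>\<^sub>C 'a) set))"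
proof -
  note cs = assms(1)
  note cpt = cantor_compact[OF cs]
  have star: "Gamma_star P \<subseteq> (Cs :: ('a \<Rightarrow>\<^sub>C 'a) set)" for P by (auto simp: Gamma_star_def)
  have incr: "Gamma_set K \<subseteq> Gamma_set (Gamma_star (Gamma_set K) :: ('a \<Rightarrow>\<^sub>C 'a) set)"
    by (intro Gamma_set_mono subset_Gamma_star assms(5))
  have a: "Gamma_set (Gamma_star Q :: ('a \<Rightarrow>\<^sub>C 'a) set) \<subseteq> Q"
    "K \<subseteq> Gamma_star (Gamma_set K)"
    "Gamma_star (Gamma_set (Gamma_star Q :: ('a \<Rightarrow>\<^sub>C 'a) set)) = (Gamma_star Q :: ('a \<Rightarrow>\<^sub>C 'a) set)"
    "Gamma_set K = Gamma_set (Gamma_star (Gamma_set K) :: ('a \<Rightarrow>\<^sub>C 'a) set)"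
  proof -
    show "Gamma_set (Gamma_star Q :: ('a \<Rightarrow>\<^sub>C 'a) set) \<subseteq> Q" by (rule Gamma_set_Gamma_star)
    then show "Gamma_star (Gamma_set (Gamma_star Q :: ('a \<Rightarrow>\<^sub>C 'a) set)) = (Gamma_star Q :: ('a \<Rightarrow>\<^sub>C 'a) set)"
      by (intro equalityI subset_Gamma_star star) (auto simp: Gamma_star_def)
    show "K \<subseteq> Gamma_star (Gamma_set K)" by (rule subset_Gamma_star[OF assms(5)])
    show "Gamma_set K = Gamma_set (Gamma_star (Gamma_set K) :: ('a \<Rightarrow>\<^sub>C 'a) set)"
      using incr Gamma_set_Gamma_star by blast
  qed
  have d: "Gamma_set K0 = Gamma_set K" if "K \<subseteq> closure K0"
  proof
    show "Gamma_set K \<subseteq> Gamma_set K0"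
      using Gamma_closure[OF cpt] that by (auto simp: Gamma_set_def[of K])
  qed (rule Gamma_set_mono[OF assms(4)])
  have e: "conjugacy_invariant K0 \<and> conjugacy_invariant K \<and> Gamma_set K0 = Gamma_set K \<longrightarrow>
     K \<subseteq> closure K0"
    using Gamma_set_eq_imp_dense[OF cs assms(5), of K0] by simp
  \<comment> \<open>\<open>K\<close> and its hull have the same relations, so \<open>K\<close> is dense in the hull; being closed, it is all of it.\<close>
  have f1: "K = Gamma_star (Gamma_set K)"
    if K: "closedin (top_of_set Cs) K" "conjugacy_invariant K"
  proof
    have "Gamma_star (Gamma_set K) \<subseteq> closure K"
      by (rule Gamma_set_eq_imp_dense[OF cs star K(2) Gamma_set_Gamma_star])
    moreover have "Cs \<inter> closure K \<subseteq> K"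
      using K(1) by (metis closedin_closed closure_minimal inf_mono inf_le2 subset_refl)
    ultimately show "Gamma_star (Gamma_set K) \<subseteq> K" using star by blast
  qed (rule a(2))
  have f2: "K = Homeo \<inter> Gamma_star (Gamma_set K)"
    if K: "K \<subseteq> Homeo" "closedin (top_of_set Homeo) K" "conjugacy_invariant K"
  proof
    have "Gamma_set (Homeo \<inter> Gamma_star (Gamma_set K)) \<subseteq> Gamma_set K"
      using Gamma_set_mono[OF Int_lower2] Gamma_set_Gamma_star by blast
    then have "Homeo \<inter> Gamma_star (Gamma_set K) \<subseteq> closure K"
      using star by (intro Gamma_set_eq_imp_dense[OF cs _ K(3)]) auto
    moreover have "Homeo \<inter> closure K \<subseteq> K"
      using K(2) by (metis closedin_closed closure_minimal inf_mono inf_le2 subset_refl)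
    ultimately show "Homeo \<inter> Gamma_star (Gamma_set K) \<subseteq> K" by blast
  qed (use a(2) K(1) in blast)
  have g: "Q = Gamma_set (Gamma_star Q :: ('a \<Rightarrow>\<^sub>C 'a) set) \<and>
     Gamma_set (Gamma_star Q :: ('a \<Rightarrow>\<^sub>C 'a) set) =
       Gamma_set (Homeo \<inter> Gamma_star Q :: ('a \<Rightarrow>\<^sub>C 'a) set)" if "condition_Gamma Q"
    using condition_Gamma_realization[OF cs that] a(1)
      Gamma_set_mono[of "Homeo \<inter> Gamma_star Q" "Gamma_star Q :: ('a \<Rightarrow>\<^sub>C 'a) set"] by blast
  have f1': "closedin (top_of_set Cs) K \<and> conjugacy_invariant K \<longrightarrow> K = Gamma_star (Gamma_set K)"
    by (intro impI f1; elim conjE)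
  have f2': "K \<subseteq> Homeo \<and> closedin (top_of_set Homeo) K \<and> conjugacy_invariant K \<longrightarrow>
      K = Homeo \<inter> Gamma_star (Gamma_set K)"
    by (intro impI f2; elim conjE)
  show ?thesis
    by (intro conjI a closedin_Gamma_star[OF cpt] conjugacy_invariant_Gamma_star[OF cpt]
        condition_Gamma_Gamma_set[OF cs assms(3,5)] impI[OF d] e f1' f2' impI[OF g])
qed

end
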